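(* Let $G$ be a uniformly Borel amenable Følner graph on a standard Borel space $X$. Then there is a Borel set $Y\subseteq X$ which is a union of connected components of $G$ such that the restriction of $G$ to $Y$ is hyperfinite and $\mu(Y)=1$ for every $G$-invariant Borel probability measure $\mu$ on $X$. (Equivalently, $G$ is hyperfinite modulo a compressible set consisting of components of $G$.)
   Context: A Borel graph on $X$ is a symmetric loopless Borel $G\subseteq X\times X$; $d_G$ is the graph distance and $\mathcal{E}_G$ the connected-component equivalence relation. Uniformly Borel amenable: $G$ has bounded degree and for every $n\ge1$ there is a non-negative Borel $p_n:\mathcal{E}_G\to\mathbb{R}$ with (1) $\sum_{y\,\mathcal{E}_G\,x}p_n(x,y)=1$ for all $x$; (2) if $x\sim_G z$ then $\sum_{y}|p_n(x,y)-p_n(z,y)|<1/n$; (3) there is $r_n>0$ with $p_n(x,y)=0$ whenever $d_G(x,y)>r_n$. For finite $L\subseteq X$, $\partial L$ is the set of $x\in L$ with a neighbour outside $L$; $L$ is $\epsilon$-Følner if $|\partial L|/|L|<\epsilon$. $G$ is Følner if for every $\epsilon>0$ there is $r>0$ such that every ball $B_r(x)$ contains an $\epsilon$-Følner set. A Borel graph $H$ is hyperfinite if there are finite Borel equivalence relations $\mathcal{E}_1\subseteq\mathcal{E}_2\subseteq\cdots$ (all classes finite) such that for each $n$ the $H$-diameters of the classes of $\mathcal{E}_n$ are uniformly bounded, and every pair of adjacent vertices lies in the same class of $\mathcal{E}_n$ for all large $n$. A probability measure $\mu$ on $X$ is $G$-invariant if it is invariant under a Borel action of a finitely generated group whose Schreier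 graph is $G$ (equivalently, invariant with respect to $\mathcal{E}_G$). A Borel graph is compressible if there is an injective Borel map $f:X\to X$ with $f(C)\subsetneq C$ for every component $C$; by Nadkarni's theorem this is equivalent to admitting no invariant probability measure. *)

theory Defs
  imports "HOL-Probability.Probability"
begin

text \<open>A standard Borel space is modelled as a Polish space type with its Borel
  sigma-algebra. A graph is a set of ordered pairs (a relation).\<close>

definition borel_graph :: "('a::polish_space \<times> 'a) set \<Rightarrow> bool" where
  "borel_graph G \<longleftrightarrow> G \<in> sets (borel :: ('a \<times> 'a) measure) \<and> sym G \<and> irrefl G"

definition comp_rel :: "('a \<times> 'a) set \<Rightarrow> ('a \<times> 'a) set" where
  "comp_rel G = G\<^sup>*"

text \<open>Graph distance (only meaningful for vertices in the same component).\<close>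
definition gdist :: "('a \<times> 'a) set \<Rightarrow> 'a \<Rightarrow> 'a \<Rightarrow> nat" where
  "gdist G x y = (LEAST n. (x, y) \<in> G ^^ n)"

definition gball :: "('a \<times> 'a) set \<Rightarrow> real \<Rightarrow> 'a \<Rightarrow> 'a set" where
  "gball G r x = {y. (x, y) \<in> comp_rel G \<and> real (gdist G x y) \<le> r}"

definition bounded_degree :: "('a \<times> 'a) set \<Rightarrow> bool" where
  "bounded_degree G \<longleftrightarrow> (\<exists>D::nat. \<forall>x. finite (G `` {x}) \<and> card (G `` {x}) \<le> D)"

definition uniformly_borel_amenable :: "('a::polish_space \<times> 'a) set \<Rightarrow> bool" where
  "uniformly_borel_amenable G \<longleftrightarrow> bounded_degree G \<and>
     (\<forall>n::nat. n \<ge> 1 \<longrightarrow> (\<exists>p :: 'a \<times> 'a \<Rightarrow> real.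
        p \<in> borel_measurable borel \<and>
        (\<forall>x y. (x, y) \<in> comp_rel G \<longrightarrow> p (x, y) \<ge> 0) \<and>
        (\<forall>x. (\<Sum>\<^sub>\<infinity>y\<in>comp_rel G `` {x}. p (x, y)) = 1) \<and>
        (\<forall>x z. (x, z) \<in> G \<longrightarrow>
            (\<Sum>\<^sub>\<infinity>y\<in>comp_rel G `` {x}. \<bar>p (x, y) - p (z, y)\<bar>) < 1 / real n) \<and>
        (\<exists>r::real. r > 0 \<and> (\<forall>x y. (x, y) \<in> comp_rel G \<and> real (gdist G x y) > r \<longrightarrow> p (x, y) = 0))))"

definition gboundary :: "('a \<times> 'a) set \<Rightarrow> 'a set \<Rightarrow> 'a set" where
  "gboundary G L = {x \<in> L. \<exists>y. (x, y) \<in> G \<and> y \<notin> L}"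

text \<open>epsilon-Foelner set: finite (and nonempty, so that the ratio makes sense).\<close>
definition foelner_set :: "('a \<times> 'a) set \<Rightarrow> real \<Rightarrow> 'a set \<Rightarrow> bool" where
  "foelner_set G \<epsilon> L \<longleftrightarrow> finite L \<and> L \<noteq> {} \<and> real (card (gboundary G L)) / real (card L) < \<epsilon>"

definition foelner_graph :: "('a \<times> 'a) set \<Rightarrow> bool" where
  "foelner_graph G \<longleftrightarrow> (\<forall>\<epsilon>>0. \<exists>r>0. \<forall>x. \<exists>L. L \<subseteq> gball G r x \<and> foelner_set G \<epsilon> L)"

definition hyperfinite_on :: "'a::polish_space set \<Rightarrow> ('a \<times> 'a) set \<Rightarrow> bool" where
  "hyperfinite_on Y H \<longleftrightarrow> (\<exists>E :: nat \<Rightarrow> ('a \<times> 'a) set.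
      (\<forall>n. equiv Y (E n) \<and> E n \<in> sets (borel :: ('a \<times> 'a) measure)
           \<and> (\<forall>x\<in>Y. finite (E n `` {x}))) \<and>
      (\<forall>n. E n \<subseteq> E (Suc n)) \<and>
      (\<forall>n. \<exists>b::nat. \<forall>x y. (x, y) \<in> E n \<longrightarrow> (x, y) \<in> comp_rel H \<and> gdist H x y \<le> b) \<and>
      (\<forall>x y. (x, y) \<in> H \<longrightarrow> (\<exists>N. \<forall>n\<ge>N. (x, y) \<in> E n)))"

definition invariant_measure :: "('a::polish_space \<times> 'a) set \<Rightarrow> 'a measure \<Rightarrow> bool" where
  "invariant_measure E \<mu> \<longleftrightarrow> sets \<mu> = sets borel \<and> prob_space \<mu> \<and>
     (\<forall>f :: 'a \<Rightarrow> 'a. f \<in> borel_measurable borel \<and> bij f \<and> (\<forall>x. (x, f x) \<in> E)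
        \<longrightarrow> distr \<mu> \<mu> f = \<mu>)"

end

theory Submission
  imports Defs
begin

text \<open>By Novikov separation the graph is a countable union of graphs of Borel involutions, so its components
  are enumerated by countably many Borel bijections; hence every construction using quantifiers over a
  component stays Borel, and mass transport holds for every invariant measure.

  Fix \<open>\<delta> > 0\<close>. Starting from the whole space, repeatedly remove finite sets F of uniformly bounded
  diameter whose boundary, relative to what is left, has at most \<open>\<delta> |F|\<close> points, arranging
  that every shape at every base point is tried infinitely often. The remainder A contains no such F. If
  \<open>p\<close> is a transport kernel with small variation along edges, then mass transport together with the coarea
  inequality for the functions \<open>x \<mapsto> p x y\<close> on A forces A to be null for every invariant measure
  at once. The removed sets form a Borel partition into bounded pieces such that all edges outside a set
  of measure at most \<open>\<delta>\<close> stay inside a piece. Taking \<open>\<delta> = 2\<^sup>-\<^sup>n\<close> and intersecting the partitions from n on gives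
  the increasing sequence, by the Borel--Cantelli lemma.\<close>

text \<open>The obstacle is uniformity: there may be uncountably many invariant measures, so no null
  set can be discarded on the way. The partition and the exceptional set are Borel and are fixed
  before any measure is chosen; measures enter only in estimates. Why \<open>A\<close> is null: let
  \<open>R\<close> be the support radius of \<open>p\<close>. On \<open>A\<close> the superlevel
  sets of \<open>x \<mapsto> p (x, y)\<close> lie in the \<open>R\<close>-ball of \<open>y\<close>,
  so each has relative boundary at least \<delta> times its size. Integrating over the levels, the
  variation of this function along edges in \<open>A\<close> is at least \<delta> times the mass
  that \<open>A\<close> sends to \<open>y\<close>. Mass transport passes from receivers to senders:
  a point of \<open>A\<close> sends mass 1, and its edges account for variation at most
  \<open>D * \<eta>\<close>, where \<open>D\<close> bounds the degree and \<eta> the variation per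
  edge. Hence \<open>\<delta> * \<mu> A \<le> D * \<eta> * \<mu> A\<close>, and a kernel with
  \<open>D * \<eta> < \<delta>\<close> leaves only 0. Why relative boundaries suffice: an edge
  between pieces of different stages need be charged only at the end removed first. The charges of a
  stage are paid by the points removed at that stage, so in total they weigh at most
  \<delta>.\<close>

section \<open>Analytic sets and Novikov separation\<close>

text \<open>A scheme R is the graph of a continuous map from a closed subset of the Baire space:
  closedness of the domain and continuity are packed into a single condition on branches.\<close>

definition branch_limit :: "((nat \<Rightarrow> nat) \<Rightarrow> 'a::topological_space \<Rightarrow> bool) \<Rightarrow> (nat \<Rightarrow> nat) \<Rightarrow> 'a \<Rightarrow> bool" where
  "branch_limit R x z \<longleftrightarrow> R x z \<and> (\<forall>V. open V \<longrightarrow> z \<in> V \<longrightarrow>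
     (\<exists>k. \<forall>y z'. (\<forall>j<k. y j = x j) \<longrightarrow> R y z' \<longrightarrow> z' \<in> V))"

definition scheme :: "((nat \<Rightarrow> nat) \<Rightarrow> 'a::topological_space \<Rightarrow> bool) \<Rightarrow> bool" where
  "scheme R \<longleftrightarrow> (\<forall>x. (\<forall>k. \<exists>y z. (\<forall>j<k. y j = x j) \<and> R y z) \<longrightarrow> (\<exists>z. branch_limit R x z))"

text \<open>Allowing a closed domain rather than the whole Baire space covers the empty set (take
  \<open>R\<close> empty) and lets \<open>analytic_INT\<close> impose a condition on branches
  without re-parametrising them.\<close>

definition analytic :: "'a::topological_space set \<Rightarrow> bool" where
  "analytic A \<longleftrightarrow> (\<exists>R. scheme R \<and> A = {z. \<exists>x. R x z})"

lemma branch_limitD: "branch_limit R x z \<Longrightarrow> R x z"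
  by (simp add: branch_limit_def)

lemma branch_limit_nhd:
  assumes "branch_limit R x z" "open V" "z \<in> V"
  obtains k where "\<And>y z'. (\<And>j. j < k \<Longrightarrow> y j = x j) \<Longrightarrow> R y z' \<Longrightarrow> z' \<in> V"
  using assms unfolding branch_limit_def by blast

lemma branch_limitI:
  assumes "R x z" "\<And>V. open V \<Longrightarrow> z \<in> V \<Longrightarrow> \<exists>k. \<forall>y z'. (\<forall>j<k. y j = x j) \<longrightarrow> R y z' \<longrightarrow> z' \<in> V"
  shows "branch_limit R x z"
  using assms unfolding branch_limit_def by blast

lemma schemeI:
  assumes "\<And>x. (\<And>k. \<exists>y z. (\<forall>j<k. y j = x j) \<and> R y z) \<Longrightarrow> \<exists>z. branch_limit R x z"
  shows "scheme R"
  using assms unfolding scheme_def by blast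

lemma schemeD:
  assumes "scheme R" "\<And>k. \<exists>y z. (\<forall>j<k. y j = x j) \<and> R y z"
  shows "\<exists>z. branch_limit R x z"
  using assms unfolding scheme_def by blast

section \<open>Closure properties of analytic sets; Borel sets are analytic\<close>

lemma analytic_image:
  fixes f :: "'a::topological_space \<Rightarrow> 'b::topological_space"
  assumes "analytic A" "continuous_on UNIV f"
  shows "analytic (f ` A)"
proof -
  obtain R where R: "scheme R" and A: "A = {z. \<exists>x. R x z}"
    using assms(1) unfolding analytic_def by auto
  define R' where "R' = (\<lambda>x w. \<exists>z. R x z \<and> w = f z)"
  have "scheme R'"
  proof (rule schemeI)
    fix x assume H: "\<And>k. \<exists>y w. (\<forall>j<k. y j = x j) \<and> R' y w"
    have "\<exists>y z. (\<forall>j<k. y j = x j) \<and> R y z" for k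
      using H[of k] unfolding R'_def by blast
    then obtain z where z: "branch_limit R x z" using schemeD[OF R, of x] by blast
    have "branch_limit R' x (f z)"
    proof (rule branch_limitI)
      show "R' x (f z)" using branch_limitD[OF z] unfolding R'_def by blast
      fix V assume V: "open V" "f z \<in> V"
      have "open (f -` V)" using assms(2) V by (simp add: open_vimage)
      with V obtain k where "\<And>y z'. (\<And>j. j < k \<Longrightarrow> y j = x j) \<Longrightarrow> R y z' \<Longrightarrow> z' \<in> f -` V"
        using branch_limit_nhd[OF z] by (metis vimageI2)
      then show "\<exists>k. \<forall>y w. (\<forall>j<k. y j = x j) \<longrightarrow> R' y w \<longrightarrow> w \<in> V"
        unfolding R'_def by (intro exI[of _ k]) auto
    qed
    then show "\<exists>z. branch_limit R' x z" by blast
  qed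
  moreover have "f ` A = {w. \<exists>x. R' x w}" using A by (auto simp: R'_def)
  ultimately show ?thesis unfolding analytic_def by blast
qed

lemma analytic_family:
  fixes A :: "nat \<Rightarrow> 'a::topological_space set"
  assumes "\<And>i. analytic (A i)"
  obtains R where "\<And>i. scheme (R i)" "\<And>i. A i = {z. \<exists>x. R i x z}"
proof -
  have "\<forall>i. \<exists>R. scheme R \<and> A i = {z. \<exists>x. R x z}"
    using assms unfolding analytic_def by blast
  from choice[OF this] show thesis using that by blast
qed

text \<open>Coordinate 0 of a branch selects the set, the remaining coordinates are a branch of
  it.\<close>

lemma analytic_UN:
  fixes A :: "nat \<Rightarrow> 'a::topological_space set"
  assumes "\<And>i. analytic (A i)"
  shows "analytic (\<Union>i. A i)"
proof -
  obtain R where R: "\<And>i. scheme (R i)" and A: "\<And>i. A i = {z. \<exists>x. R i x z}"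
    using analytic_family[of A] assms by blast
  define R' where "R' = (\<lambda>x z. R (x 0) (\<lambda>m. x (Suc m)) z)"
  have "scheme R'"
  proof (rule schemeI)
    fix x assume H: "\<And>k. \<exists>y z. (\<forall>j<k. y j = x j) \<and> R' y z"
    have "\<exists>y z. (\<forall>j<k. y j = x (Suc j)) \<and> R (x 0) y z" for k
    proof -
      obtain y z where "\<forall>j<Suc k. y j = x j" "R' y z" using H by blast
      then show ?thesis by (intro exI[of _ "\<lambda>m. y (Suc m)"] exI[of _ z]) (auto simp: R'_def)
    qed
    then obtain z where z: "branch_limit (R (x 0)) (\<lambda>m. x (Suc m)) z"
      using schemeD[OF R[of "x 0"], of "\<lambda>m. x (Suc m)"] by blast
    have "branch_limit R' x z"
    proof (rule branch_limitI)
      show "R' x z" using branch_limitD[OF z] unfolding R'_def by simp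
      fix V assume V: "open V" "z \<in> V"
      then obtain k where k: "\<And>y z'. (\<And>j. j < k \<Longrightarrow> y j = x (Suc j)) \<Longrightarrow> R (x 0) y z' \<Longrightarrow> z' \<in> V"
        using branch_limit_nhd[OF z] by metis
      have "z' \<in> V" if "\<forall>j<Suc k. y j = x j" "R' y z'" for y z'
        using that by (intro k[of "\<lambda>m. y (Suc m)"]) (auto simp: R'_def)
      then show "\<exists>k. \<forall>y z'. (\<forall>j<k. y j = x j) \<longrightarrow> R' y z' \<longrightarrow> z' \<in> V" by blast
    qed
    then show "\<exists>z. branch_limit R' x z" by blast
  qed
  moreover have "\<exists>x. R' x z" if "R i x z" for i x z
    using that by (intro exI[of _ "case_nat i x"]) (simp add: R'_def)
  then have "(\<Union>i. A i) = {z. \<exists>x. R' x z}"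
    unfolding A by (auto simp: R'_def)
  ultimately show ?thesis unfolding analytic_def by blast
qed

text \<open>For interleaved sequences: the first \<open>prod_encode (n, k)\<close> entries contain
  the first \<open>k\<close> entries of the \<open>n\<close>-th subsequence.\<close>

lemma prod_encode_strict_mono: "m < k \<Longrightarrow> prod_encode (n, m) < prod_encode (n, k)"
proof -
  have "prod_encode (n, m) < prod_encode (n, Suc m)" for m
    by (simp add: prod_encode_def triangle_def)
  then show "m < k \<Longrightarrow> prod_encode (n, m) < prod_encode (n, k)"
    using lift_Suc_mono_less[of "\<lambda>m. prod_encode (n, m)"] by blast
qed

text \<open>One branch interleaves a branch for every set, and the domain is cut down to those whose
  branches all name the same point. It stays closed because distinct limits would have disjoint
  neighbourhoods, while every prefix still admits a common value.\<close>

lemma analytic_INT: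
  fixes A :: "nat \<Rightarrow> 'a::t2_space set"
  assumes "\<And>i. analytic (A i)"
  shows "analytic (\<Inter>i. A i)"
proof -
  obtain R where R: "\<And>i. scheme (R i)" and A: "\<And>i. A i = {z. \<exists>x. R i x z}"
    using analytic_family[of A] assms by blast
  define co where "co = (\<lambda>(n::nat) (x::nat \<Rightarrow> nat) m. x (prod_encode (n, m)))"
  have co_agree: "\<forall>j<k. co n y j = co n x j" if "\<forall>j<prod_encode (n, k). y j = x j" for k n x y
    using that prod_encode_strict_mono by (auto simp: co_def)
  define R' where "R' = (\<lambda>x z. \<forall>n. R n (co n x) z)"
  have "scheme R'"
  proof (rule schemeI)
    fix x assume H: "\<And>k. \<exists>y z. (\<forall>j<k. y j = x j) \<and> R' y z"
    have "\<exists>y z. (\<forall>j<k. y j = co n x j) \<and> R n y z" for k n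
    proof -
      obtain y z where "\<forall>j<prod_encode (n, k). y j = x j" "R' y z" using H by blast
      then show ?thesis
        using co_agree[of n k y x] unfolding R'_def by (intro exI[of _ "co n y"] exI[of _ z]) simp
    qed
    then have "\<forall>n. \<exists>z. branch_limit (R n) (co n x) z"
      by (intro allI schemeD[OF R])
    then obtain z where z: "\<And>n. branch_limit (R n) (co n x) (z n)" by metis
    have nbhd: "\<exists>k. \<forall>y z'. (\<forall>j<k. y j = x j) \<longrightarrow> R' y z' \<longrightarrow> z' \<in> V" if V: "open V" "z n \<in> V" for V n
    proof -
      obtain k where "\<And>y z'. (\<And>j. j < k \<Longrightarrow> y j = co n x j) \<Longrightarrow> R n y z' \<Longrightarrow> z' \<in> V"
        using branch_limit_nhd[OF z V] by metis
      then have "\<forall>y z'. (\<forall>j<prod_encode (n, k). y j = x j) \<longrightarrow> R' y z' \<longrightarrow> z' \<in> V"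
        using co_agree unfolding R'_def by blast
      then show ?thesis by blast
    qed
    have "z n = z 0" for n
    proof (rule ccontr)
      assume "z n \<noteq> z 0"
      then obtain U V where UV: "open U" "open V" "z n \<in> U" "z 0 \<in> V" "U \<inter> V = {}"
        using hausdorff by metis
      obtain k where k: "\<forall>y z'. (\<forall>j<k. y j = x j) \<longrightarrow> R' y z' \<longrightarrow> z' \<in> U"
        using nbhd[OF UV(1,3)] by blast
      obtain l where l: "\<forall>y z'. (\<forall>j<l. y j = x j) \<longrightarrow> R' y z' \<longrightarrow> z' \<in> V"
        using nbhd[OF UV(2,4)] by blast
      obtain y z' where y: "\<forall>j<max k l. y j = x j" "R' y z'" using H by blast
      have "z' \<in> U" using k y(2) y(1)[rule_format] less_max_iff_disj by blast
      moreover have "z' \<in> V" using l y(2) y(1)[rule_format] less_max_iff_disj by blast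
      ultimately show False using UV(5) by blast
    qed
    then have "R' x (z 0)" using branch_limitD[OF z] unfolding R'_def by metis
    then have "branch_limit R' x (z 0)" by (rule branch_limitI) (rule nbhd)
    then show "\<exists>z. branch_limit R' x z" by blast
  qed
  moreover have "\<exists>x. R' x z" if H: "\<And>i. z \<in> A i" for z
  proof -
    obtain f where f: "\<And>i. R i (f i) z" using H unfolding A mem_Collect_eq by metis
    show ?thesis
      by (intro exI[of _ "\<lambda>j. f (fst (prod_decode j)) (snd (prod_decode j))"])
         (simp add: R'_def co_def f)
  qed
  then have "(\<Inter>i. A i) = {z. \<exists>x. R' x z}"
    unfolding R'_def A by blast
  ultimately show ?thesis unfolding analytic_def by blast
qed

lemma dense_sequence:
  obtains d :: "nat \<Rightarrow> 'a::{metric_space, second_countable_topology}"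
  where "\<And>z e. 0 < e \<Longrightarrow> \<exists>i. dist z (d i) < e"
proof -
  obtain D :: "'a set" where D: "countable D" "\<And>X. open X \<Longrightarrow> X \<noteq> {} \<Longrightarrow> \<exists>d\<in>D. d \<in> X"
    using countable_dense_setE by blast
  have "D \<noteq> {}" using D(2)[of UNIV] by auto
  have "\<exists>i. dist z (from_nat_into D i) < e" if "0 < e" for z :: 'a and e
  proof -
    have "ball z e \<noteq> {}" using that by simp
    then obtain d where d: "d \<in> D" "d \<in> ball z e" using D(2)[of "ball z e"] by auto
    obtain i where "from_nat_into D i = d"
      using from_nat_into_surj[OF D(1) d(1)] by blast
    then show ?thesis using d(2) by (auto simp: dist_commute)
  qed
  then show thesis by (rule that)
qed

lemma analytic_closed:
  fixes C :: "'a::{complete_space, second_countable_topology} set"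
  assumes "closed C"
  shows "analytic C"
proof -
  obtain d :: "nat \<Rightarrow> 'a" where d: "\<And>z e. 0 < e \<Longrightarrow> \<exists>i. dist z (d i) < e"
    using dense_sequence by blast
  \<comment> \<open>\<open>x\<close> names \<open>z\<close> through the points
    \<open>d (x k)\<close>, within \<open>2^-k\<close> of it. The inequality is not strict so that
    it passes to the limit of the points \<open>w k\<close>, each of which meets only the first
    \<open>k\<close> conditions.\<close>
  define R where "R = (\<lambda>x z. z \<in> C \<and> (\<forall>k. dist z (d (x k)) \<le> (1/2)^k))"
  have "scheme R"
  proof (rule schemeI)
    fix x assume H: "\<And>k. \<exists>y z. (\<forall>j<k. y j = x j) \<and> R y z"
    have "\<forall>k. \<exists>z. z \<in> C \<and> (\<forall>j<k. dist z (d (x j)) \<le> (1/2)^j)"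
      using H unfolding R_def by metis
    then obtain w where w: "\<And>k. w k \<in> C" "\<And>k j. j < k \<Longrightarrow> dist (w k) (d (x j)) \<le> (1/2)^j"
      by metis
    have small: "\<exists>k. (1/2)^k < e" if "0 < e" for e :: real
      using real_arch_pow_inv[OF that, of "1/2"] by auto
    have "Cauchy w"
    proof (rule metric_CauchyI)
      fix e :: real assume "0 < e"
      then obtain k where k: "(1/2)^k < e/2" using small[of "e/2"] by auto
      have "dist (w m) (w n) < e" if "m \<ge> Suc k" "n \<ge> Suc k" for m n
      proof -
        have "dist (w m) (w n) \<le> dist (w m) (d (x k)) + dist (w n) (d (x k))"
          by (rule dist_triangle2)
        then show ?thesis using w(2)[of k m] w(2)[of k n] k that by simp
      qed
      then show "\<exists>M. \<forall>m\<ge>M. \<forall>n\<ge>M. dist (w m) (w n) < e" by blast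
    qed
    then obtain z where z: "w \<longlonglongrightarrow> z" using Cauchy_convergent convergent_def by blast
    have "z \<in> C" using closed_sequentially[OF assms _ z] w(1) by blast
    have zd: "dist z (d (x j)) \<le> (1/2)^j" for j
    proof (rule tendsto_upperbound)
      show "(\<lambda>k. dist (w k) (d (x j))) \<longlonglongrightarrow> dist z (d (x j))" by (intro tendsto_intros z)
      show "\<forall>\<^sub>F k in sequentially. dist (w k) (d (x j)) \<le> (1/2)^j"
        using eventually_gt_at_top[of j] by eventually_elim (rule w(2))
    qed simp
    have "branch_limit R x z"
    proof (rule branch_limitI)
      show "R x z" using \<open>z \<in> C\<close> zd unfolding R_def by blast
      fix V assume V: "open V" "z \<in> V"
      obtain e where e: "0 < e" "\<And>z'. dist z' z < e \<Longrightarrow> z' \<in> V" using V open_dist by metis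
      obtain k where k: "(1/2)^k < e/2" using small[of "e/2"] e(1) by auto
      have "z' \<in> V" if "\<forall>j<Suc k. y j = x j" "R y z'" for y z'
      proof (rule e(2))
        have "dist z' (d (x k)) \<le> (1/2)^k" using that unfolding R_def by (metis lessI)
        moreover have "dist z' z \<le> dist z' (d (x k)) + dist z (d (x k))" by (rule dist_triangle2)
        ultimately show "dist z' z < e" using zd[of k] k by simp
      qed
      then show "\<exists>k. \<forall>y z'. (\<forall>j<k. y j = x j) \<longrightarrow> R y z' \<longrightarrow> z' \<in> V" by blast
    qed
    then show "\<exists>z. branch_limit R x z" by blast
  qed
  moreover have "\<exists>x. R x z" if "z \<in> C" for z
  proof -
    have "\<forall>k. \<exists>i. dist z (d i) < (1/2)^k" using d by simp
    then obtain x where "\<forall>k. dist z (d (x k)) < (1/2)^k" by metis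
    then show ?thesis using that unfolding R_def by (intro exI[of _ x]) (auto intro: less_imp_le)
  qed
  then have "C = {z. \<exists>x. R x z}" unfolding R_def by blast
  ultimately show ?thesis unfolding analytic_def by blast
qed

lemma analytic_open:
  fixes U :: "'a::{complete_space, second_countable_topology} set"
  assumes "open U"
  shows "analytic U"
\<comment> \<open>\<open>infdist\<close> to the empty set is 0 by convention, so the exhaustion by
  closed sets below needs a nonempty complement.\<close>
proof (cases "U = UNIV")
  case True
  then show ?thesis by (simp add: analytic_closed)
next
  case False
  then have ne: "- U \<noteq> {}" by auto
  have "U = (\<Union>n. {x. 1 / real (Suc n) \<le> infdist x (- U)})"
  proof (intro set_eqI iffI)
    fix x assume "x \<in> U"
    then have "0 < infdist x (- U)"
      using in_closed_iff_infdist_zero[of "- U" x] ne assms infdist_nonneg[of x "- U"]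
      by (auto simp: closed_Compl order_less_le)
    then show "x \<in> (\<Union>n. {x. 1 / real (Suc n) \<le> infdist x (- U)})"
      using nat_approx_posE[of "infdist x (- U)"] by (auto intro: less_imp_le)
  next
    fix x assume "x \<in> (\<Union>n. {x. 1 / real (Suc n) \<le> infdist x (- U)})"
    then obtain n where "1 / real (Suc n) \<le> infdist x (- U)" by blast
    moreover have "0 < 1 / real (Suc n)" by simp
    ultimately have "infdist x (- U) \<noteq> 0" by linarith
    then show "x \<in> U" using infdist_zero by blast
  qed
  moreover have "analytic (\<Union>n. {x. 1 / real (Suc n) \<le> infdist x (- U)})"
    by (intro analytic_UN analytic_closed closed_Collect_le continuous_intros)
  ultimately show ?thesis by simp
qed

lemma analytic_borel:
  fixes A :: "'a::{complete_space, second_countable_topology} set"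
  assumes "A \<in> sets borel"
  shows "analytic A"
proof -
  \<comment> \<open>Analyticity does not pass to complements, so the induction carries the
    complement along.\<close>
  have "analytic A \<and> analytic (- A)"
    using assms unfolding sets_borel
  proof (induction A rule: sigma_sets.induct)
    case (Basic a)
    then have "open a" by simp
    have "analytic a" using \<open>open a\<close> by (rule analytic_open)
    moreover have "analytic (- a)" using \<open>open a\<close> by (intro analytic_closed) (simp add: closed_Compl)
    ultimately show ?case ..
  next
    case Empty
    show ?case by (auto intro!: analytic_closed)
  next
    case (Compl a)
    then show ?case by (simp add: Compl_eq_Diff_UNIV double_diff)
  next
    case (Union a)
    then show ?case by (auto intro!: analytic_UN analytic_INT simp: Compl_UN)
  qed
  then show ?thesis ..
qed

text \<open>Lusin's argument for countably many sets at once (Novikov): if the sets could not be separated,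
  one could extend the prefixes one coordinate at a time without ever making the pieces
  separable, and in the limit two of the branches would have distinct limit points.\<close>

lemma novikov_separation:
  fixes A :: "nat \<Rightarrow> 'a::t2_space set"
  assumes "\<And>n. analytic (A n)" and "(\<Inter>n. A n) = {}"
  obtains B where "\<And>n. B n \<in> sets borel" "\<And>n. A n \<subseteq> B n" "(\<Inter>n. B n) = {}"
proof -
  define sep :: "(nat \<Rightarrow> 'a set) \<Rightarrow> bool" where
    "sep = (\<lambda>A. \<exists>B. (\<forall>n. B n \<in> sets borel \<and> A n \<subseteq> B n) \<and> (\<Inter>n. B n) = {})"
  obtain R where R: "\<And>i. scheme (R i)" and A: "\<And>i. A i = {z. \<exists>x. R i x z}"
    using analytic_family[of A] assms by blast
  \<comment> \<open>\<open>x\<close> interleaves one branch per set, and \<open>N k x n\<close> is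
    the part of \<open>A n\<close> compatible with the first \<open>k\<close> entries of
    \<open>x\<close>. Each further entry belongs to a single branch, so only one set of the family
    is split.\<close>
  define N where "N = (\<lambda>k x n. {z. \<exists>y. (\<forall>m. prod_encode (n, m) < k \<longrightarrow> y m = x (prod_encode (n, m))) \<and> R n y z})"
  have N_cong: "N k x = N k y" if "\<forall>j<k. x j = y j" for k and x y :: "nat \<Rightarrow> nat"
    unfolding N_def using that by (intro ext) (metis (no_types, lifting))
  have step: "\<exists>a. \<not> sep (N (Suc k) (x(k := a)))" if nsep: "\<not> sep (N k x)" for k x
  proof (rule ccontr)
    assume "\<not> ?thesis"
    then have "\<forall>a. \<exists>B. (\<forall>n. B n \<in> sets borel \<and> N (Suc k) (x(k := a)) n \<subseteq> B n) \<and> (\<Inter>n. B n) = {}"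
      unfolding sep_def by blast
    then obtain B where B: "\<And>a n. B a n \<in> sets borel" "\<And>a n. N (Suc k) (x(k := a)) n \<subseteq> B a n"
      "\<And>a. (\<Inter>n. B a n) = {}" by metis
    obtain n0 m0 where nm: "k = prod_encode (n0, m0)" by (metis prod_decode_inverse surj_pair)
    \<comment> \<open>Union of the separators for the set being split, intersection for the others:
      a point in all \<open>B' n\<close> lies in \<open>B a n0\<close> for one \<open>a\<close>, and
      then in \<open>B a n\<close> for every \<open>n\<close>.\<close>
    define B' where "B' = (\<lambda>n. if n = n0 then (\<Union>a. B a n) else (\<Inter>a. B a n))"
    have "B' n \<in> sets borel" for n unfolding B'_def using B(1) by auto
    moreover have "N k x n \<subseteq> B' n" for n
    proof (cases "n = n0")
      case True
      have "z \<in> (\<Union>a. N (Suc k) (x(k := a)) n0)" if z: "z \<in> N k x n0" for z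
      proof -
        obtain y where y: "\<forall>m. prod_encode (n0, m) < k \<longrightarrow> y m = x (prod_encode (n0, m))" "R n0 y z"
          using z unfolding N_def by blast
        have "z \<in> N (Suc k) (x(k := y m0)) n0"
          unfolding N_def using y by (auto simp: nm less_Suc_eq intro!: exI[of _ y])
        then show ?thesis by blast
      qed
      then show ?thesis using True B(2) unfolding B'_def by fastforce
    next
      case False
      have "N k x n \<subseteq> N (Suc k) (x(k := a)) n" for a
        unfolding N_def using False by (auto simp: nm less_Suc_eq)
      then show ?thesis using False B(2) unfolding B'_def by fastforce
    qed
    moreover have "(\<Inter>n. B' n) = {}"
    proof -
      have False if z: "\<And>n. z \<in> B' n" for z
      proof -
        obtain a where "z \<in> B a n0" using z[of n0] unfolding B'_def by auto
        moreover have "z \<in> B a n" if "n \<noteq> n0" for n using z[of n] that unfolding B'_def by auto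
        ultimately have "z \<in> B a n" for n by (cases "n = n0") auto
        then have "z \<in> (\<Inter>n. B a n)" by blast
        then show False using B(3) by blast
      qed
      then show ?thesis by blast
    qed
    ultimately have "sep (N k x)" unfolding sep_def by blast
    with nsep show False ..
  qed
  have "sep A"
  proof (rule ccontr)
    assume "\<not> sep A"
    moreover have "N 0 x = A" for x unfolding N_def A by auto
    ultimately have start: "\<not> sep (N 0 (\<lambda>_. 0))" by simp
    have "\<exists>f. \<forall>k. \<not> sep (N k (f k)) \<and> (\<exists>a. f (Suc k) = (f k)(k := a))"
    proof (rule dependent_nat_choice)
      show "\<exists>x. \<not> sep (N 0 x)" using start by blast
    next
      fix x k assume "\<not> sep (N k x)"
      then show "\<exists>y. \<not> sep (N (Suc k) y) \<and> (\<exists>a. y = x(k := a))" using step by blast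
    qed
    then obtain f where f: "\<And>k. \<not> sep (N k (f k))" "\<And>k. \<exists>a. f (Suc k) = (f k)(k := a)" by blast
    define x where "x = (\<lambda>j. f (Suc j) j)"
    have fx: "j < k \<Longrightarrow> f k j = x j" for k j
    proof (induction k)
      case (Suc k)
      then show ?case using f(2)[of k] by (cases "j = k") (auto simp: x_def)
    qed simp
    have nsep: "\<not> sep (N k x)" for k
      using f(1)[of k] N_cong[of k "f k" x] fx by simp
    \<comment> \<open>An empty piece would make the family separable at once, so every prefix of
      every branch stays inhabited and \<open>scheme\<close> yields limits.\<close>
    have "\<exists>y z. (\<forall>j<k. y j = x (prod_encode (n, j))) \<and> R n y z" for k n
    proof (rule ccontr)
      assume H: "\<not> ?thesis"
      have "N (prod_encode (n, k)) x n = {}"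
        unfolding N_def using H prod_encode_strict_mono by blast
      then have "sep (N (prod_encode (n, k)) x)"
        unfolding sep_def by (intro exI[of _ "\<lambda>i. if i = n then {} else UNIV"]) auto
      then show False using nsep by blast
    qed
    then have "\<forall>n. \<exists>z. branch_limit (R n) (\<lambda>j. x (prod_encode (n, j))) z"
      by (intro allI schemeD[OF R])
    then obtain z where z: "\<And>n. branch_limit (R n) (\<lambda>j. x (prod_encode (n, j))) (z n)" by metis
    have zA: "z n \<in> A n" for n using branch_limitD[OF z] unfolding A by blast
    have nhd: "\<exists>k. \<forall>l\<ge>k. N l x n \<subseteq> V" if V: "open V" "z n \<in> V" for V n
    proof -
      obtain k where k: "\<And>y z'. (\<And>j. j < k \<Longrightarrow> y j = x (prod_encode (n, j))) \<Longrightarrow> R n y z' \<Longrightarrow> z' \<in> V"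
        using branch_limit_nhd[OF z V] by metis
      have "N l x n \<subseteq> V" if "l \<ge> prod_encode (n, k)" for l
      proof
        fix z' assume "z' \<in> N l x n"
        then obtain y where y: "\<And>m. prod_encode (n, m) < l \<Longrightarrow> y m = x (prod_encode (n, m))" "R n y z'"
          unfolding N_def by blast
        show "z' \<in> V"
          by (rule k[OF y(1) y(2)]) (use that prod_encode_strict_mono less_le_trans in blast)
      qed
      then show ?thesis by blast
    qed
    have "z n = z 0" for n
    proof (rule ccontr)
      assume ne: "z n \<noteq> z 0"
      then obtain U V where UV: "open U" "open V" "z n \<in> U" "z 0 \<in> V" "U \<inter> V = {}"
        using hausdorff by metis
      obtain k where k: "\<forall>l\<ge>k. N l x n \<subseteq> U" using nhd[OF UV(1,3)] by blast
      obtain l where l: "\<forall>k\<ge>l. N k x 0 \<subseteq> V" using nhd[OF UV(2,4)] by blast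
      have "n \<noteq> 0" using ne by metis
      have "sep (N (max k l) x)"
        unfolding sep_def
      proof (intro exI conjI allI)
        let ?B = "\<lambda>i. if i = n then U else if i = 0 then V else UNIV"
        show "?B i \<in> sets borel" for i using UV by auto
        show "N (max k l) x i \<subseteq> ?B i" for i using k l by auto
        have "(\<Inter>i. ?B i) \<subseteq> ?B n \<inter> ?B 0" by blast
        also have "\<dots> = {}" using UV(5) \<open>n \<noteq> 0\<close> by auto
        finally show "(\<Inter>i. ?B i) = {}" by blast
      qed
      then show False using nsep by blast
    qed
    then have "z 0 \<in> (\<Inter>n. A n)" using zA by (metis INT_I)
    then show False using assms(2) by blast
  qed
  then show thesis unfolding sep_def using that by blast
qed

lemma lusin_separation:
  fixes A B :: "'a::t2_space set"
  assumes "analytic A" "analytic B" "A \<inter> B = {}"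
  obtains S where "S \<in> sets borel" "A \<subseteq> S" "S \<inter> B = {}"
proof -
  obtain C where C: "\<And>n::nat. C n \<in> sets borel" "\<And>n. (if n = 0 then A else B) \<subseteq> C n" "(\<Inter>n. C n) = {}"
    by (rule novikov_separation[of "\<lambda>n. if n = 0 then A else B"])
       (use assms in \<open>auto split: if_splits\<close>)
  show thesis
  proof (rule that)
    show "C 0 \<in> sets borel" "A \<subseteq> C 0" using C(1,2)[of 0] by auto
    have "B \<subseteq> C n" if "n \<noteq> 0" for n using C(2)[of n] that by simp
    then show "C 0 \<inter> B = {}" using C(3) by (metis (no_types, lifting) INT_I disjoint_iff empty_iff subsetD)
  qed
qed

section \<open>Borel sets with finite sections\<close>

text \<open>Turns the choice of a point from a finite set into the choice of an index from a
  countable list, which keeps the later constructions Borel.\<close>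

lemma separating_basis:
  obtains U :: "nat \<Rightarrow> 'a::{metric_space, second_countable_topology} set"
  where "\<And>i. open (U i)" "\<And>S y. finite S \<Longrightarrow> \<exists>i. y \<in> U i \<and> U i \<inter> S \<subseteq> {y}"
proof -
  obtain B :: "'a set set" where B: "countable B" "topological_basis B"
    using ex_countable_basis by blast
  then have "B \<noteq> {}" by (metis UNIV_I empty_iff open_UNIV topological_basisE)
  have "open (from_nat_into B i)" for i
    using from_nat_into[OF \<open>B \<noteq> {}\<close>] B(2) topological_basis_open by blast
  moreover have "\<exists>i. y \<in> from_nat_into B i \<and> from_nat_into B i \<inter> S \<subseteq> {y}" if "finite S" for S y
  proof -
    have "open (- (S - {y}))" using that by (intro open_Compl finite_imp_closed) simp
    then obtain V where V: "V \<in> B" "y \<in> V" "V \<subseteq> - (S - {y})"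
      using topological_basisE[OF B(2)] by (metis ComplI DiffD2 insertI1)
    then obtain i where "from_nat_into B i = V" using from_nat_into_surj[OF B(1)] by blast
    then show ?thesis using V by blast
  qed
  ultimately show thesis by (rule that)
qed

lemma sets_borel_prod:
  "sets (borel \<Otimes>\<^sub>M borel) = sets (borel :: ('a::second_countable_topology \<times> 'b::second_countable_topology) measure)"
  by (rule arg_cong[OF borel_prod])

lemma analytic_fst:
  fixes B :: "('a::{complete_space, second_countable_topology} \<times> 'b::{complete_space, second_countable_topology}) set"
  assumes "B \<in> sets borel"
  shows "analytic (fst ` B)"
  by (intro analytic_image analytic_borel assms continuous_intros)

text \<open>As a projection, the domain of \<open>B\<close> is so far known only to be analytic.
  Lusin separation replaces the preimage of each ball by a Borel set that agrees with it on the
  domain; the function is then rebuilt as a limit of approximations from a dense sequence.\<close>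

lemma single_valued_borel_extends:
  fixes B :: "('a::{complete_space, second_countable_topology} \<times> 'b::{complete_space, second_countable_topology}) set"
  assumes B: "B \<in> sets borel" and sv: "single_valued B"
  obtains f where "f \<in> borel_measurable borel" "\<And>x y. (x, y) \<in> B \<Longrightarrow> y = f x"
proof -
  obtain d :: "nat \<Rightarrow> 'b" where d: "\<And>z e. 0 < e \<Longrightarrow> \<exists>i. dist z (d i) < e"
    using dense_sequence by blast
  define U where "U = (\<lambda>j m. {y. dist y (d j) < 1 / real (Suc m)})"
  have [measurable]: "{z :: 'a \<times> 'b. snd z \<in> U j m} \<in> sets borel" for j m
    unfolding U_def mem_Collect_eq by (intro borel_open open_Collect_less continuous_intros)
  have "\<exists>S\<in>sets borel. \<forall>x y. (x, y) \<in> B \<longrightarrow> (x \<in> S \<longleftrightarrow> y \<in> U j m)" for j m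
  proof -
    have sets: "B \<inter> {z. snd z \<in> U j m} \<in> sets borel" "B - {z. snd z \<in> U j m} \<in> sets borel"
      using B by auto
    have disj: "fst ` (B \<inter> {z. snd z \<in> U j m}) \<inter> fst ` (B - {z. snd z \<in> U j m}) = {}"
      using sv by (auto dest: single_valuedD)
    obtain S where "S \<in> sets borel" "fst ` (B \<inter> {z. snd z \<in> U j m}) \<subseteq> S"
      "S \<inter> fst ` (B - {z. snd z \<in> U j m}) = {}"
      by (rule lusin_separation[OF analytic_fst[OF sets(1)] analytic_fst[OF sets(2)] disj])
    then show ?thesis by (intro bexI[of _ S]) force+
  qed
  then obtain S where [measurable]: "\<And>j m. S j m \<in> sets borel"
    and S: "\<And>j m x y. (x, y) \<in> B \<Longrightarrow> x \<in> S j m \<longleftrightarrow> y \<in> U j m" by metis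
  define c where "c = (\<lambda>m x. d (LEAST j. x \<in> S j m))"
  have [measurable]: "c m \<in> borel_measurable borel" for m
    unfolding c_def
    by (rule measurable_compose[of "\<lambda>x. LEAST j. x \<in> S j m" borel "count_space UNIV" d]) simp_all
  \<comment> \<open>Off the domain of \<open>B\<close> the approximations may diverge; the constant
    \<open>d 0\<close> makes the sequence converge everywhere.\<close>
  define u where "u = (\<lambda>m x. if Cauchy (\<lambda>m. c m x) then c m x else d 0)"
  have [measurable]: "u m \<in> borel_measurable borel" for m
    unfolding u_def by measurable
  have conv: "convergent (\<lambda>m. u m x)" for x
    by (cases "Cauchy (\<lambda>m. c m x)") (auto simp: u_def Cauchy_convergent convergent_const)
  define f where "f = (\<lambda>x. lim (\<lambda>m. u m x))"
  have "f \<in> borel_measurable borel"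
    by (rule borel_measurable_LIMSEQ_metric[of u])
       (use conv in \<open>auto simp: f_def convergent_LIMSEQ_iff\<close>)
  moreover have "y = f x" if xy: "(x, y) \<in> B" for x y
  proof -
    have c: "dist (c m x) y < 1 / real (Suc m)" for m
    proof -
      obtain i where "dist y (d i) < 1 / real (Suc m)" using d[of "1 / real (Suc m)" y] by auto
      then have "x \<in> S i m" using S[OF xy] by (simp add: U_def)
      then have "x \<in> S (LEAST j. x \<in> S j m) m" by (rule LeastI)
      then show ?thesis using S[OF xy] by (simp add: U_def c_def dist_commute)
    qed
    have "(\<lambda>m. dist (c m x) y) \<longlonglongrightarrow> 0"
    proof (rule tendsto_sandwich[OF _ _ tendsto_const LIMSEQ_inverse_real_of_nat])
      show "\<forall>\<^sub>F m in sequentially. 0 \<le> dist (c m x) y" by simp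
      show "\<forall>\<^sub>F m in sequentially. dist (c m x) y \<le> inverse (real (Suc m))"
        using less_imp_le[OF c] by (simp add: inverse_eq_divide)
    qed
    then have "(\<lambda>m. c m x) \<longlonglongrightarrow> y" by (rule tendsto_dist_iff[THEN iffD2])
    moreover from this have "Cauchy (\<lambda>m. c m x)" by (rule LIMSEQ_imp_Cauchy)
    ultimately show ?thesis by (simp add: f_def u_def limI)
  qed
  ultimately show thesis by (rule that)
qed

text \<open>The points of a finite section isolated by a basic open set form only a coanalytic set;
  Novikov's theorem shrinks these coanalytic sets to Borel ones that still cover.\<close>

lemma finite_sections_decompose:
  fixes B :: "('a::{complete_space, second_countable_topology} \<times> 'b::{complete_space, second_countable_topology}) set"
  assumes B: "B \<in> sets borel" and fin: "\<And>x. finite (B `` {x})"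
  obtains C :: "nat \<Rightarrow> ('a \<times> 'b) set"
  where "\<And>i. C i \<in> sets borel" "\<And>i. single_valued (C i)" "(\<Union>i. C i) = B"
proof -
  obtain U :: "nat \<Rightarrow> 'b set" where U: "\<And>i. open (U i)"
    "\<And>S y. finite S \<Longrightarrow> \<exists>i. y \<in> U i \<and> U i \<inter> S \<subseteq> {y}"
    using separating_basis by metis
  \<comment> \<open>\<open>A i\<close> collects the pairs that \<open>U i\<close> fails to isolate
    in their section. It is the projection of \<open>T i\<close>, whose extra coordinate is the
    witness \<open>y'\<close>, or any point of the section if \<open>y\<close> is outside
    \<open>U i\<close>.\<close>
  define A where "A = (\<lambda>i. {(x, y) \<in> B. y \<notin> U i \<or> (\<exists>y'. y' \<noteq> y \<and> y' \<in> U i \<and> (x, y') \<in> B)})"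
  define T where "T = (\<lambda>i. {w :: ('a \<times> 'b) \<times> 'b. fst w \<in> B \<and> (fst (fst w), snd w) \<in> B \<and>
      (snd (fst w) \<in> - U i \<or> (snd w \<in> U i \<and> snd w \<noteq> snd (fst w)))})"
  have T: "T i \<in> sets borel" for i
  proof -
    have [measurable]: "B \<in> sets (borel \<Otimes>\<^sub>M borel)" "U i \<in> sets borel"
      using B U(1) by (simp_all add: sets_borel_prod)
    have "T i = {w \<in> space ((borel \<Otimes>\<^sub>M borel) \<Otimes>\<^sub>M borel). fst w \<in> B \<and> (fst (fst w), snd w) \<in> B \<and>
      (\<not> snd (fst w) \<in> U i \<or> (snd w \<in> U i \<and> \<not> snd w = snd (fst w)))}"
      by (auto simp: T_def space_pair_measure)
    also have "\<dots> \<in> sets ((borel \<Otimes>\<^sub>M borel) \<Otimes>\<^sub>M borel)"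
      by measurable
    finally show ?thesis unfolding borel_prod .
  qed
  have "A i = fst ` T i" for i
    by (force simp: A_def T_def image_iff)
  then have "analytic (A i)" for i
    using analytic_fst[OF T] by simp
  moreover have "(\<Inter>i. A i) = {}"
  proof -
    have False if A: "\<And>i. (x, y) \<in> A i" for x y
    proof -
      obtain i where "y \<in> U i" "U i \<inter> B `` {x} \<subseteq> {y}" using U(2)[OF fin] by metis
      then show False using A[of i] unfolding A_def by blast
    qed
    then show ?thesis by auto
  qed
  ultimately obtain D where D: "\<And>i. D i \<in> sets borel" "\<And>i. A i \<subseteq> D i" "(\<Inter>i. D i) = {}"
    using novikov_separation[of A] by metis
  show thesis
  proof (rule that)
    show "B - D i \<in> sets borel" for i using B D(1) by simp
    show "single_valued (B - D i)" for i
      using D(2)[of i] unfolding single_valued_def A_def by blast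
    show "(\<Union>i. B - D i) = B" using D(3) by auto
  qed
qed

section \<open>Enumeration of components and mass transport\<close>

lemma converse_borel:
  fixes M :: "('a::second_countable_topology \<times> 'b::second_countable_topology) set"
  assumes "M \<in> sets borel"
  shows "M\<inverse> \<in> sets borel"
proof -
  have "M \<in> sets (borel \<Otimes>\<^sub>M borel)" using assms by (simp add: sets_borel_prod)
  then have "(\<lambda>(y, x). (x, y)) -` M \<inter> space (borel \<Otimes>\<^sub>M borel) \<in> sets (borel \<Otimes>\<^sub>M borel)"
    by (rule measurable_sets[OF measurable_pair_swap'])
  moreover have "M\<inverse> = (\<lambda>(y, x). (x, y)) -` M \<inter> space (borel \<Otimes>\<^sub>M borel)"
    by (auto simp: space_pair_measure)
  ultimately show ?thesis by (simp add: sets_borel_prod)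
qed

text \<open>As no point is both a first and a second coordinate, the pairs of \<open>M\<close> can
  be swapped and all other points fixed. Testing \<open>(x, f x) \<in> M\<close> with a total Borel
  \<open>f\<close> recognises first coordinates without a projection.\<close>

lemma matching_involution:
  fixes M :: "('a::polish_space \<times> 'a) set"
  assumes M: "M \<in> sets borel" and sv: "single_valued M" "single_valued (M\<inverse>)"
    and disj: "Domain M \<inter> Range M = {}"
  obtains h where "h \<in> borel_measurable borel" "\<And>x. h (h x) = x"
    "\<And>x. h x = x \<or> (x, h x) \<in> M \<or> (h x, x) \<in> M" "\<And>x y. (x, y) \<in> M \<Longrightarrow> h x = y"
proof -
  obtain f where [measurable]: "f \<in> borel_measurable borel" and f: "\<And>x y. (x, y) \<in> M \<Longrightarrow> y = f x"
    using single_valued_borel_extends[OF M sv(1)] by metis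
  obtain g where [measurable]: "g \<in> borel_measurable borel" and g: "\<And>x y. (x, y) \<in> M\<inverse> \<Longrightarrow> y = g x"
    using single_valued_borel_extends[OF converse_borel[OF M] sv(2)] by metis
  have [measurable]: "M \<in> sets (borel \<Otimes>\<^sub>M borel)" using M by (simp add: sets_borel_prod)
  define h where "h = (\<lambda>x. if (x, f x) \<in> M then f x else if (g x, x) \<in> M then g x else x)"
  have hM: "h x = y" if "(x, y) \<in> M" for x y
    using f that unfolding h_def by metis
  have hM': "h y = x" if "(x, y) \<in> M" for x y
  proof -
    have "(y, f y) \<notin> M" using that disj by blast
    then show ?thesis using g[of y x] that unfolding h_def by auto
  qed
  show thesis
  proof (rule that)
    show "h \<in> borel_measurable borel" unfolding h_def by measurable
    show h: "h x = x \<or> (x, h x) \<in> M \<or> (h x, x) \<in> M" for x unfolding h_def by auto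
    show "h (h x) = x" for x using h[of x] hM hM' by metis
    show "h x = y" if "(x, y) \<in> M" for x y using that by (rule hM)
  qed
qed

text \<open>Feldman-Moore for a locally finite graph. In \<open>M\<close>, the set
  \<open>C i\<close> makes partners unique forwards, the converse of \<open>C j\<close> backwards,
  and \<open>U a\<close> against its complement keeps sources and targets apart; since there are no
  loops, every edge falls in some \<open>M t\<close>.\<close>

lemma generating_involutions:
  fixes G :: "('a::polish_space \<times> 'a) set"
  assumes G: "borel_graph G" and fin: "\<And>x. finite (G `` {x})"
  obtains h :: "nat \<Rightarrow> 'a \<Rightarrow> 'a" where "\<And>k. h k \<in> borel_measurable borel" "\<And>k x. h k (h k x) = x"
    "\<And>k x. h k x = x \<or> (x, h k x) \<in> G" "\<And>x y. (x, y) \<in> G \<Longrightarrow> \<exists>k. h k x = y"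
proof -
  have GB: "G \<in> sets borel" and symG: "sym G" and irr: "irrefl G"
    using G unfolding borel_graph_def by auto
  obtain C where C: "\<And>i::nat. C i \<in> sets borel" "\<And>i. single_valued (C i)" "(\<Union>i. C i) = G"
    using finite_sections_decompose[OF GB fin] by blast
  obtain U :: "nat \<Rightarrow> 'a set" where U: "\<And>i. open (U i)"
    "\<And>S y. finite S \<Longrightarrow> \<exists>i. y \<in> U i \<and> U i \<inter> S \<subseteq> {y}"
    using separating_basis by metis
  define M where "M = (\<lambda>(i, j, a). C i \<inter> (C j)\<inverse> \<inter> (U a \<times> - U a))"
  have "\<exists>h. h \<in> borel_measurable borel \<and> (\<forall>x. h (h x) = x) \<and>
    (\<forall>x. h x = x \<or> (x, h x) \<in> M t \<or> (h x, x) \<in> M t) \<and> (\<forall>x y. (x, y) \<in> M t \<longrightarrow> h x = y)" for t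
  proof -
    obtain i j a where t: "t = (i, j, a)" by (cases t)
    have "U a \<times> - U a \<in> sets (borel \<Otimes>\<^sub>M borel)"
      using U(1)[of a] by (intro pair_measureI) auto
    then have "M t \<in> sets borel"
      using C(1) converse_borel[OF C(1)] by (auto simp: M_def t sets_borel_prod)
    moreover have "single_valued (M t)" "single_valued ((M t)\<inverse>)"
      using C(2)[of i] C(2)[of j] unfolding M_def t by (auto simp: single_valued_def)
    moreover have "Domain (M t) \<inter> Range (M t) = {}" unfolding M_def t by auto
    ultimately show ?thesis by (rule matching_involution) blast
  qed
  then obtain h where h: "\<And>t. h t \<in> borel_measurable borel" "\<And>t x. h t (h t x) = x"
    "\<And>t x. h t x = x \<or> (x, h t x) \<in> M t \<or> (h t x, x) \<in> M t" "\<And>t x y. (x, y) \<in> M t \<Longrightarrow> h t x = y"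
    by metis
  have MG: "M t \<subseteq> G" for t using C(3) by (auto simp: M_def split: prod.splits)
  show thesis
  proof (rule that[of "\<lambda>k. h (from_nat k)"])
    show "h (from_nat k) \<in> borel_measurable borel" "h (from_nat k) (h (from_nat k) x) = x" for k x
      by (rule h)+
    show "h (from_nat k) x = x \<or> (x, h (from_nat k) x) \<in> G" for k x
      using h(3)[of "from_nat k" x] MG symG by (meson subsetD symD)
    show "\<exists>k. h (from_nat k) x = y" if xy: "(x, y) \<in> G" for x y
    proof -
      obtain i where "(x, y) \<in> C i" using xy C(3) by blast
      moreover obtain j where "(y, x) \<in> C j" using symD[OF symG xy] C(3) by blast
      moreover obtain a where "x \<in> U a" "U a \<inter> {x, y} \<subseteq> {x}" using U(2)[of "{x, y}"] by blast
      moreover have "x \<noteq> y" using xy irr by (auto simp: irrefl_def)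
      ultimately have "(x, y) \<in> M (i, j, a)" by (auto simp: M_def)
      then show ?thesis using h(4) by (metis from_nat_to_nat)
    qed
  qed
qed

text \<open>Finite words in the involutions reach the whole component, and reversing a word inverts
  it. Bijections are wanted rather than mere enumerating functions, because invariance of a measure
  speaks of bijections only.\<close>

lemma component_enumeration:
  fixes G :: "('a::polish_space \<times> 'a) set"
  assumes G: "borel_graph G" and fin: "\<And>x. finite (G `` {x})"
  obtains e e' :: "nat \<Rightarrow> 'a \<Rightarrow> 'a" where "\<And>k. e k \<in> borel_measurable borel"
    "\<And>k. e' k \<in> borel_measurable borel" "\<And>k x. e k (e' k x) = x" "\<And>k x. e' k (e k x) = x"
    "\<And>x. G\<^sup>* `` {x} = range (\<lambda>k. e k x)"
proof -
  obtain h :: "nat \<Rightarrow> 'a \<Rightarrow> 'a" where h: "\<And>k. h k \<in> borel_measurable borel" "\<And>k x. h k (h k x) = x"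
    "\<And>k x. h k x = x \<or> (x, h k x) \<in> G" "\<And>x y. (x, y) \<in> G \<Longrightarrow> \<exists>k. h k x = y"
    using generating_involutions[OF assms] by metis
  have meas: "fold h w \<in> borel_measurable borel" for w
  proof (induction w)
    case (Cons k w)
    then show ?case using h(1)[of k] by (simp add: measurable_comp)
  qed (simp add: id_def)
  have inv: "fold h (rev w) (fold h w x) = x" for w x
    by (induction w arbitrary: x) (simp_all add: h(2))
  have inv': "fold h w (fold h (rev w) x) = x" for w x
    using inv[of "rev w"] by simp
  have 1: "(x, fold h w x) \<in> G\<^sup>*" for w x
  proof (induction w arbitrary: x)
    case (Cons k w)
    have "(x, h k x) \<in> G\<^sup>*" using h(3)[of k x] by auto
    then show ?case using Cons[of "h k x"] by simp
  qed simp
  have 2: "\<exists>w. fold h w x = y" if "(x, y) \<in> G\<^sup>*" for x y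
    using that
  proof (induction rule: converse_rtrancl_induct)
    case base
    show ?case by (intro exI[of _ "[]"]) simp
  next
    case (step x z)
    then obtain k w where "h k x = z" "fold h w z = y" using h(4) by blast
    then show ?case by (intro exI[of _ "k # w"]) simp
  qed
  show thesis
  proof (rule that[of "\<lambda>k. fold h (from_nat k)" "\<lambda>k. fold h (rev (from_nat k))"])
    show "G\<^sup>* `` {x} = range (\<lambda>k. fold h (from_nat k) x)" for x
      using 1 2 by (auto simp: image_iff) (metis from_nat_to_nat)
  qed (simp_all add: meas inv inv')
qed

text \<open>Only the first index of each point of the range is counted; the resulting series turns sums over
  components into measurable functions.\<close>

lemma nn_integral_count_space_range:
  fixes f :: "nat \<Rightarrow> 'a"
  shows "(\<integral>\<^sup>+y. \<phi> y \<partial>count_space (range f)) = (\<Sum>k. \<phi> (f k) * indicator {k. \<forall>j<k. f j \<noteq> f k} k)"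
proof -
  define K where "K = {k. \<forall>j<k. f j \<noteq> f k}"
  have "bij_betw f K (range f)"
    unfolding bij_betw_def
  proof
    show "inj_on f K"
    proof (rule linorder_inj_onI')
      fix i j assume "i \<in> K" "j \<in> K" "i < j"
      then show "f i \<noteq> f j" by (simp add: K_def)
    qed
    have "f k \<in> f ` K" for k
    proof -
      have "f (LEAST j. f j = f k) = f k" by (rule LeastI) simp
      moreover have "(LEAST j. f j = f k) \<in> K"
        unfolding K_def mem_Collect_eq calculation using not_less_Least by blast
      ultimately show ?thesis by (metis image_eqI)
    qed
    then show "f ` K = range f" by blast
  qed
  then have "(\<integral>\<^sup>+y. \<phi> y \<partial>count_space (range f)) = (\<integral>\<^sup>+k. \<phi> (f k) \<partial>count_space K)"
    by (rule nn_integral_bij_count_space[symmetric])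
  also have "\<dots> = (\<integral>\<^sup>+k. \<phi> (f k) * indicator K k \<partial>count_space UNIV)"
    by (rule nn_integral_count_space_indicator) simp
  also have "\<dots> = (\<Sum>k. \<phi> (f k) * indicator K k)"
    by (rule nn_integral_count_space_nat)
  finally show ?thesis unfolding K_def .
qed

section \<open>Countable Borel equivalence relations and mass transport\<close>

locale borel_enumeration =
  fixes E :: "('a::polish_space \<times> 'a) set" and e e' :: "nat \<Rightarrow> 'a \<Rightarrow> 'a"
  assumes equivE: "equiv UNIV E"
    and e_measurable[measurable]: "\<And>k. e k \<in> borel_measurable borel"
    and e'_measurable[measurable]: "\<And>k. e' k \<in> borel_measurable borel"
    and e_e'[simp]: "\<And>k x. e k (e' k x) = x"
    and e'_e[simp]: "\<And>k x. e' k (e k x) = x"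
    and range_e: "\<And>x. E `` {x} = range (\<lambda>k. e k x)"
begin

lemma E_refl[simp]: "(x, x) \<in> E"
  using equivE by (auto simp: equiv_def refl_on_def)

lemma E_sym: "(x, y) \<in> E \<Longrightarrow> (y, x) \<in> E"
  using equivE by (meson equiv_def symD)

lemma E_trans: "(x, y) \<in> E \<Longrightarrow> (y, z) \<in> E \<Longrightarrow> (x, z) \<in> E"
  using equivE by (meson equiv_def transD)

lemma E_e[simp]: "(x, e k x) \<in> E"
  using range_e by blast

lemma E_iff: "(x, y) \<in> E \<longleftrightarrow> (\<exists>k. y = e k x)"
  using range_e by blast

lemma range_e': "E `` {x} = range (\<lambda>k. e' k x)"
proof -
  have "y \<in> E `` {x} \<longleftrightarrow> y \<in> range (\<lambda>k. e' k x)" for y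
  proof -
    have "(x, y) \<in> E \<longleftrightarrow> (\<exists>k. x = e k y)" using E_sym E_iff by blast
    also have "\<dots> \<longleftrightarrow> (\<exists>k. y = e' k x)" by (metis e_e' e'_e)
    finally show ?thesis by auto
  qed
  then show ?thesis by blast
qed

lemma class_integral_measurable:
  assumes [measurable]: "f \<in> borel_measurable M" "(\<lambda>(m, y). \<phi> m y) \<in> borel_measurable (M \<Otimes>\<^sub>M borel)"
  shows "(\<lambda>m. \<integral>\<^sup>+y. \<phi> m y \<partial>count_space (E `` {f m})) \<in> borel_measurable M"
proof -
  have "(\<lambda>m. \<Sum>k. \<phi> m (e k (f m)) * (if \<forall>j<k. e j (f m) \<noteq> e k (f m) then 1 else 0)) \<in> borel_measurable M"
    by measurable
  then show ?thesis
    unfolding range_e nn_integral_count_space_range indicator_def by simp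
qed

text \<open>Both sides are series over \<open>k\<close>, matched term by term by the substitution
  \<open>e' k\<close>, which preserves \<mu>. The first-index condition survives since
  \<open>e j (e' k x) = x\<close> iff \<open>e' j x = e' k x\<close>.\<close>

lemma mass_transport:
  assumes \<mu>: "invariant_measure E \<mu>"
    and \<phi>[measurable]: "(\<lambda>(x, y). \<phi> x y) \<in> borel_measurable (borel \<Otimes>\<^sub>M borel)"
  shows "(\<integral>\<^sup>+x. \<integral>\<^sup>+y. \<phi> x y \<partial>count_space (E `` {x}) \<partial>\<mu>) =
         (\<integral>\<^sup>+x. \<integral>\<^sup>+y. \<phi> y x \<partial>count_space (E `` {x}) \<partial>\<mu>)"
proof -
  have sets[measurable_cong]: "sets \<mu> = sets borel" using \<mu> by (simp add: invariant_measure_def)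
  define F where "F = (\<lambda>k x. \<phi> x (e k x) * indicator {k. \<forall>j<k. e j x \<noteq> e k x} k)"
  define F' where "F' = (\<lambda>k x. \<phi> (e' k x) x * indicator {k. \<forall>j<k. e' j x \<noteq> e' k x} k)"
  have F[measurable]: "F k \<in> borel_measurable borel" for k
  proof -
    have "(\<lambda>x. \<phi> x (e k x) * (if \<forall>j<k. e j x \<noteq> e k x then 1 else 0)) \<in> borel_measurable borel"
      by measurable
    then show ?thesis unfolding F_def indicator_def by simp
  qed
  have F'[measurable]: "F' k \<in> borel_measurable borel" for k
  proof -
    have "(\<lambda>x. \<phi> (e' k x) x * (if \<forall>j<k. e' j x \<noteq> e' k x then 1 else 0)) \<in> borel_measurable borel"
      by measurable
    then show ?thesis unfolding F'_def indicator_def by simp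
  qed
  have int: "(\<integral>\<^sup>+x. F k x \<partial>\<mu>) = (\<integral>\<^sup>+x. F' k x \<partial>\<mu>)" for k
  proof -
    have "bij (e' k)" by (rule o_bij[of "e k"]) (auto simp: fun_eq_iff)
    moreover have "(x, e' k x) \<in> E" for x using range_e' by blast
    ultimately have "distr \<mu> \<mu> (e' k) = \<mu>"
      using \<mu> by (simp add: invariant_measure_def)
    then have "(\<integral>\<^sup>+x. F k x \<partial>\<mu>) = (\<integral>\<^sup>+x. F k x \<partial>distr \<mu> \<mu> (e' k))" by simp
    also have "\<dots> = (\<integral>\<^sup>+x. F k (e' k x) \<partial>\<mu>)"
      by (rule nn_integral_distr) measurable
    also have "\<dots> = (\<integral>\<^sup>+x. F' k x \<partial>\<mu>)"
    proof (rule nn_integral_cong)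
      fix x
      have "e j (e' k x) = x \<longleftrightarrow> e' j x = e' k x" for j by (metis e_e' e'_e)
      then show "F k (e' k x) = F' k x" unfolding F_def F'_def by (simp add: indicator_def)
    qed
    finally show ?thesis .
  qed
  have "(\<integral>\<^sup>+x. \<integral>\<^sup>+y. \<phi> x y \<partial>count_space (E `` {x}) \<partial>\<mu>) = (\<integral>\<^sup>+x. (\<Sum>k. F k x) \<partial>\<mu>)"
    unfolding range_e nn_integral_count_space_range F_def ..
  also have "\<dots> = (\<Sum>k. \<integral>\<^sup>+x. F k x \<partial>\<mu>)" by (rule nn_integral_suminf) measurable
  also have "\<dots> = (\<Sum>k. \<integral>\<^sup>+x. F' k x \<partial>\<mu>)" by (simp add: int)
  also have "\<dots> = (\<integral>\<^sup>+x. (\<Sum>k. F' k x) \<partial>\<mu>)" by (rule nn_integral_suminf[symmetric]) measurable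
  also have "\<dots> = (\<integral>\<^sup>+x. \<integral>\<^sup>+y. \<phi> y x \<partial>count_space (E `` {x}) \<partial>\<mu>)"
    unfolding range_e' nn_integral_count_space_range F'_def ..
  finally show ?thesis .
qed

end

section \<open>Isoperimetry and null sets\<close>

text \<open>Links the infinite sums in the definition of amenability with the integrals of mass
  transport.\<close>

lemma nn_integral_count_space_eq_infsum:
  fixes f :: "'a \<Rightarrow> real"
  assumes S: "finite S" "S \<subseteq> B" and nonneg: "\<And>x. x \<in> B \<Longrightarrow> 0 \<le> f x" and zero: "\<And>x. x \<in> B - S \<Longrightarrow> f x = 0"
  shows "(\<integral>\<^sup>+x. ennreal (f x) \<partial>count_space B) = ennreal (infsum f B)"
proof -
  have "(\<integral>\<^sup>+x. ennreal (f x) \<partial>count_space B) = (\<Sum>x\<in>S. ennreal (f x))"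
    by (rule nn_integral_count_space') (use S zero in auto)
  also have "\<dots> = ennreal (\<Sum>x\<in>S. f x)"
    by (rule sum_ennreal) (use S nonneg in auto)
  also have "(\<Sum>x\<in>S. f x) = infsum f B"
  proof -
    have "infsum f B = infsum f S"
      by (rule infsum_cong_neutral) (use S zero in auto)
    then show ?thesis using S by simp
  qed
  finally show ?thesis .
qed

text \<open>For \<open>A = UNIV\<close> this is \<open>gboundary G F\<close>. Edges to vertices
  outside \<open>A\<close>, in the application those removed earlier, are not counted.\<close>

definition bdry :: "('a \<times> 'a) set \<Rightarrow> 'a set \<Rightarrow> 'a set \<Rightarrow> 'a set" where
  "bdry G A F = {x \<in> F. \<exists>y. (x, y) \<in> G \<and> y \<in> A \<and> y \<notin> F}"

text \<open>Coarea inequality: integrate the isoperimetric inequality for the superlevel sets of q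
  over the level.\<close>

lemma isoperimetric_coarea:
  fixes q :: "'a \<Rightarrow> real"
  assumes S: "finite S" "S \<subseteq> A" and pos: "\<And>x. x \<in> S \<Longrightarrow> 0 \<le> q x" and zero: "\<And>x. x \<in> A - S \<Longrightarrow> q x = 0"
    and lf: "\<And>x. finite (G `` {x})" and "0 \<le> \<delta>"
    and iso: "\<And>F. F \<subseteq> S \<Longrightarrow> F \<noteq> {} \<Longrightarrow> \<delta> * real (card F) \<le> real (card (bdry G A F))"
  shows "ennreal \<delta> * (\<Sum>x\<in>S. ennreal (q x)) \<le> (\<Sum>x\<in>S. \<Sum>z\<in>G `` {x} \<inter> A. ennreal \<bar>q x - q z\<bar>)"
proof -
  \<comment> \<open>On \<open>A\<close> outside \<open>S\<close> the value is 0, so the superlevel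
    sets at levels \<open>t \<ge> 0\<close> stay inside \<open>S\<close>. The indicators below
    integrate over \<open>t\<close> to \<open>q x\<close> and to the positive part of
    \<open>q x - q z\<close>; at a fixed level each boundary vertex is paid for by one edge crossing
    it.\<close>
  have q0: "0 \<le> q x" if "x \<in> A" for x using pos zero that by (cases "x \<in> S") auto
  have level: "ennreal \<delta> * (\<Sum>x\<in>S. indicator {0..<q x} t) \<le>
      (\<Sum>x\<in>S. \<Sum>z\<in>G `` {x} \<inter> A. indicator {q z..<q x} t)" for t :: real
  proof (cases "0 \<le> t")
    case False
    then have "(\<Sum>x\<in>S. indicator {0..<q x} t) = (0 :: ennreal)"
      by (intro sum.neutral) (auto simp: indicator_def)
    then show ?thesis by simp
  next
    case True
    define F where "F = {x \<in> S. t < q x}"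
    have "finite F" using S by (simp add: F_def)
    have "(\<Sum>x\<in>S. indicator {0..<q x} t) = (\<Sum>x\<in>F. 1 :: ennreal)"
      unfolding F_def using S True by (intro sum.mono_neutral_cong_right) (auto simp: indicator_def)
    then have L: "(\<Sum>x\<in>S. indicator {0..<q x} t) = ennreal (real (card F))"
      by (simp add: ennreal_of_nat_eq_real_of_nat)
    have 1: "1 \<le> (\<Sum>z\<in>G `` {x} \<inter> A. indicator {q z..<q x} t :: ennreal)" if x: "x \<in> bdry G A F" for x
    proof -
      obtain z where z: "(x, z) \<in> G" "z \<in> A" "z \<notin> F" and "x \<in> F"
        using x unfolding bdry_def by blast
      have "q z \<le> t" using z zero True by (cases "z \<in> S") (auto simp: F_def)
      then have "1 = (indicator {q z..<q x} t :: ennreal)" using \<open>x \<in> F\<close> by (simp add: F_def)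
      also have "\<dots> \<le> (\<Sum>z\<in>G `` {x} \<inter> A. indicator {q z..<q x} t)"
        using z lf by (intro member_le_sum) auto
      finally show ?thesis .
    qed
    have bs: "bdry G A F \<subseteq> S" unfolding bdry_def F_def by auto
    have "ennreal \<delta> * ennreal (real (card F)) = ennreal (\<delta> * real (card F))"
      using \<open>0 \<le> \<delta>\<close> by (simp add: ennreal_mult)
    also have "\<dots> \<le> ennreal (real (card (bdry G A F)))"
    proof (cases "F = {}")
      case False
      then show ?thesis using iso[of F] by (intro ennreal_leI) (auto simp: F_def)
    qed simp
    also have "\<dots> = (\<Sum>x\<in>bdry G A F. 1)"
      by (simp add: ennreal_of_nat_eq_real_of_nat)
    also have "\<dots> \<le> (\<Sum>x\<in>bdry G A F. \<Sum>z\<in>G `` {x} \<inter> A. indicator {q z..<q x} t)"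
      by (rule sum_mono) (rule 1)
    also have "\<dots> \<le> (\<Sum>x\<in>S. \<Sum>z\<in>G `` {x} \<inter> A. indicator {q z..<q x} t)"
      using bs S by (intro sum_mono2) auto
    finally show ?thesis unfolding L .
  qed
  have "ennreal \<delta> * (\<Sum>x\<in>S. ennreal (q x)) = (\<integral>\<^sup>+t. ennreal \<delta> * (\<Sum>x\<in>S. indicator {0..<q x} t) \<partial>lborel)"
    using pos by (simp add: nn_integral_cmult nn_integral_sum)
  also have "\<dots> \<le> (\<integral>\<^sup>+t. (\<Sum>x\<in>S. \<Sum>z\<in>G `` {x} \<inter> A. indicator {q z..<q x} t) \<partial>lborel)"
    by (rule nn_integral_mono) (rule level)
  also have "\<dots> = (\<Sum>x\<in>S. \<Sum>z\<in>G `` {x} \<inter> A. emeasure lborel {q z..<q x})"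
    by (simp add: nn_integral_sum)
  also have "\<dots> \<le> (\<Sum>x\<in>S. \<Sum>z\<in>G `` {x} \<inter> A. ennreal \<bar>q x - q z\<bar>)"
  proof (intro sum_mono)
    fix x z
    show "emeasure lborel {q z..<q x} \<le> ennreal \<bar>q x - q z\<bar>"
      by (cases "q z \<le> q x") auto
  qed
  finally show ?thesis .
qed

section \<open>Bounded-distance relations in a bounded degree Borel graph, and the null set
  criterion\<close>

locale borel_graph_enumeration = borel_enumeration "G\<^sup>*" e e'
  for G :: "('a::polish_space \<times> 'a) set" and e e' +
  fixes D :: nat
  assumes G_borel: "borel_graph G"
    and finite_nbrs: "\<And>x. finite (G `` {x})"
    and card_nbrs: "\<And>x. card (G `` {x}) \<le> D"
begin

lemma G_sets[measurable]: "G \<in> sets (borel \<Otimes>\<^sub>M borel)"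
  using G_borel by (simp add: borel_graph_def sets_borel_prod)

lemma G_sym: "(x, y) \<in> G \<Longrightarrow> (y, x) \<in> G"
  using G_borel by (meson borel_graph_def symD)

text \<open>Pairs at distance at most \<open>n\<close>, with no minimum over path lengths: Borelness
  and composition are then direct, and pairs in different components need no convention.\<close>

definition reach :: "nat \<Rightarrow> ('a \<times> 'a) set" where
  "reach n = (\<Union>k\<le>n. G ^^ k)"

text \<open>A composition of Borel relations is in general a projection; here the intermediate point
  ranges over countably many Borel functions of the first one. The device recurs wherever a vertex
  is quantified.\<close>

lemma relpow_sets[measurable]: "G ^^ n \<in> sets (borel \<Otimes>\<^sub>M borel)"
proof (induction n)
  case 0
  have "(Id :: ('a \<times> 'a) set) = {p \<in> space (borel \<Otimes>\<^sub>M borel). fst p = snd p}"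
    by (auto simp: space_pair_measure)
  also have "\<dots> \<in> sets (borel \<Otimes>\<^sub>M borel)" by measurable
  finally show ?case by simp
next
  case (Suc n)
  note [measurable] = Suc
  have "G ^^ Suc n = {p \<in> space (borel \<Otimes>\<^sub>M borel). \<exists>j. (fst p, e j (fst p)) \<in> G ^^ n \<and> (e j (fst p), snd p) \<in> G}"
  proof -
    have "\<exists>j. z = e j x" if "(x, z) \<in> G ^^ n" for x z
      using relpow_imp_rtrancl[OF that] E_iff by blast
    then show ?thesis by (fastforce simp: space_pair_measure)
  qed
  also have "\<dots> \<in> sets (borel \<Otimes>\<^sub>M borel)" by measurable
  finally show ?case .
qed

lemma reach_sets[measurable]: "reach n \<in> sets (borel \<Otimes>\<^sub>M borel)"
  unfolding reach_def by measurable

lemma relpow_sym: "(x, y) \<in> G ^^ n \<Longrightarrow> (y, x) \<in> G ^^ n"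
proof (induction n arbitrary: y)
  case (Suc n)
  then obtain z where "(x, z) \<in> G ^^ n" "(z, y) \<in> G" by auto
  then show ?case using Suc.IH G_sym relpow_Suc_I2 by metis
qed auto

lemma reach_sym: "(x, y) \<in> reach n \<Longrightarrow> (y, x) \<in> reach n"
  unfolding reach_def using relpow_sym by blast

lemma reach_E: "(x, y) \<in> reach n \<Longrightarrow> (x, y) \<in> G\<^sup>*"
  unfolding reach_def using relpow_imp_rtrancl by blast

lemma reach_trans: "(x, y) \<in> reach m \<Longrightarrow> (y, z) \<in> reach n \<Longrightarrow> (x, z) \<in> reach (m + n)"
proof -
  assume "(x, y) \<in> reach m" "(y, z) \<in> reach n"
  then obtain k l where "k \<le> m" "(x, y) \<in> G ^^ k" "l \<le> n" "(y, z) \<in> G ^^ l"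
    unfolding reach_def by blast
  then have "(x, z) \<in> G ^^ (k + l)" "k + l \<le> m + n" by (auto simp: relpow_add)
  then show ?thesis unfolding reach_def by blast
qed

lemma finite_reach: "finite (reach n `` {x})"
proof -
  have "finite ((G ^^ k) `` {x})" for k
  proof (induction k)
    case (Suc k)
    have "(G ^^ Suc k) `` {x} = (\<Union>z\<in>(G ^^ k) `` {x}. G `` {z})" by auto
    then show ?case using Suc finite_nbrs by simp
  qed (simp add: Image_def)
  moreover have "reach n `` {x} = (\<Union>k\<le>n. (G ^^ k) `` {x})" unfolding reach_def by blast
  ultimately show ?thesis by simp
qed

text \<open>A countable Borel colouring, with overlaps, of the graph that joins distinct points at
  distance at most \<open>n\<close>: a point of \<open>U i\<close> gets colour \<open>i\<close> if
  \<open>U i\<close> contains no other point of its \<open>n\<close>-ball.\<close>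

lemma separated_cover:
  obtains W :: "nat \<Rightarrow> 'a set" where "\<And>i. W i \<in> sets borel" "\<And>x. \<exists>i. x \<in> W i"
    "\<And>i x y. x \<in> W i \<Longrightarrow> y \<in> W i \<Longrightarrow> (x, y) \<in> reach n \<Longrightarrow> x = y"
proof -
  obtain U :: "nat \<Rightarrow> 'a set" where U: "\<And>i. open (U i)"
    "\<And>S y. finite S \<Longrightarrow> \<exists>i. y \<in> U i \<and> U i \<inter> S \<subseteq> {y}"
    using separating_basis by metis
  have [measurable]: "U i \<in> sets borel" for i using U(1) by simp
  define W where "W = (\<lambda>i. {x \<in> U i. \<forall>m. e m x \<in> U i \<longrightarrow> (x, e m x) \<in> reach n \<longrightarrow> e m x = x})"
  show thesis
  proof (rule that)
    have "W i = {x \<in> space borel. x \<in> U i \<and> (\<forall>m. e m x \<in> U i \<longrightarrow> (x, e m x) \<in> reach n \<longrightarrow> e m x = x)}" for i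
      by (auto simp: W_def)
    also have "\<dots> i \<in> sets borel" for i by measurable
    finally show "W i \<in> sets borel" for i .
    show "\<exists>i. x \<in> W i" for x
    proof -
      obtain i where "x \<in> U i" "U i \<inter> reach n `` {x} \<subseteq> {x}" using U(2)[OF finite_reach] by metis
      then show ?thesis unfolding W_def by blast
    qed
    show "x = y" if W: "x \<in> W i" "y \<in> W i" "(x, y) \<in> reach n" for i x y
    proof -
      have "(x, y) \<in> G\<^sup>*" using W(3) by (rule reach_E)
      then obtain m where "y = e m x" using E_iff by blast
      then show ?thesis using W unfolding W_def by auto
    qed
  qed
qed

text \<open>Transport the mass p x y from x in A to y, and compare for each y the total mass received
  with the total variation of p along the edges in A.\<close>

lemma null_set_without_foelner_subsets:
  assumes \<mu>: "invariant_measure (G\<^sup>*) \<mu>" and A[measurable]: "A \<in> sets borel"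
    and p[measurable]: "p \<in> borel_measurable (borel \<Otimes>\<^sub>M borel)"
    and nonneg: "\<And>x y. (x, y) \<in> G\<^sup>* \<Longrightarrow> 0 \<le> p (x, y)"
    and sum1: "\<And>x. (\<Sum>\<^sub>\<infinity>y\<in>G\<^sup>* `` {x}. p (x, y)) = 1"
    and grad: "\<And>x z. (x, z) \<in> G \<Longrightarrow> (\<Sum>\<^sub>\<infinity>y\<in>G\<^sup>* `` {x}. \<bar>p (x, y) - p (z, y)\<bar>) \<le> \<eta>"
    and supp: "\<And>x y. (x, y) \<in> G\<^sup>* \<Longrightarrow> p (x, y) \<noteq> 0 \<Longrightarrow> (x, y) \<in> reach R"
    and "0 \<le> \<eta>" "real D * \<eta> < \<delta>"
    and iso: "\<And>b F. F \<subseteq> A \<inter> reach R `` {b} \<Longrightarrow> F \<noteq> {} \<Longrightarrow> \<delta> * real (card F) \<le> real (card (bdry G A F))"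
  shows "emeasure \<mu> A = 0"
proof -
  have sets[measurable_cong]: "sets \<mu> = sets borel" and "prob_space \<mu>"
    using \<mu> by (simp_all add: invariant_measure_def)
  interpret prob_space \<mu> by fact
  have "0 \<le> \<delta>" using assms(8,9) by (meson le_less_trans less_imp_le mult_nonneg_nonneg of_nat_0_le_iff)
  \<comment> \<open>Written as an integral over the component so that
    \<open>class_integral_measurable\<close> applies; fact \<open>g\<close> below turns it into a
    finite sum.\<close>
  define g where "g = (\<lambda>x y. \<integral>\<^sup>+z. ennreal \<bar>p (x, y) - p (z, y)\<bar> * indicator {z. (x, z) \<in> G \<and> z \<in> A} z \<partial>count_space (G\<^sup>* `` {x}))"
  have [measurable]: "(\<lambda>w. g (fst w) (snd w)) \<in> borel_measurable (borel \<Otimes>\<^sub>M borel)"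
  proof -
    have "(\<lambda>w. \<integral>\<^sup>+z. ennreal \<bar>p (fst w, snd w) - p (z, snd w)\<bar> * of_bool ((fst w, z) \<in> G \<and> z \<in> A)
        \<partial>count_space (G\<^sup>* `` {fst w})) \<in> borel_measurable (borel \<Otimes>\<^sub>M borel)"
      unfolding of_bool_def by (rule class_integral_measurable) measurable
    then show ?thesis unfolding g_def indicator_def by simp
  qed
  have g: "g x y = (\<Sum>z\<in>G `` {x} \<inter> A. ennreal \<bar>p (x, y) - p (z, y)\<bar>)" for x y
  proof -
    have "g x y = (\<Sum>z\<in>G `` {x} \<inter> A. ennreal \<bar>p (x, y) - p (z, y)\<bar> * indicator {z. (x, z) \<in> G \<and> z \<in> A} z)"
      unfolding g_def by (rule nn_integral_count_space') (use finite_nbrs in auto)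
    then show ?thesis by (auto intro!: sum.cong)
  qed
  define \<phi> where "\<phi> = (\<lambda>x y. indicator A x * ennreal (p (x, y)))"
  define \<psi> where "\<psi> = (\<lambda>x y. indicator A x * g x y)"
  have [measurable]: "(\<lambda>(x, y). \<phi> x y) \<in> borel_measurable (borel \<Otimes>\<^sub>M borel)"
    unfolding \<phi>_def by measurable
  have [measurable]: "(\<lambda>(x, y). \<psi> x y) \<in> borel_measurable (borel \<Otimes>\<^sub>M borel)"
    unfolding \<psi>_def case_prod_beta by measurable
  have \<phi>_out: "(\<integral>\<^sup>+y. \<phi> x y \<partial>count_space (G\<^sup>* `` {x})) = indicator A x" for x
  proof -
    have "(\<integral>\<^sup>+y. ennreal (p (x, y)) \<partial>count_space (G\<^sup>* `` {x})) = ennreal (\<Sum>\<^sub>\<infinity>y\<in>G\<^sup>* `` {x}. p (x, y))"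
      by (rule nn_integral_count_space_eq_infsum[OF finite_reach[of R x]])
         (use nonneg supp reach_E in auto)
    then show ?thesis unfolding \<phi>_def by (simp add: nn_integral_cmult sum1)
  qed
  have \<psi>_out: "(\<integral>\<^sup>+y. \<psi> x y \<partial>count_space (G\<^sup>* `` {x})) \<le> indicator A x * ennreal (real D * \<eta>)" for x
  proof -
    have edge: "(\<integral>\<^sup>+y. ennreal \<bar>p (x, y) - p (z, y)\<bar> \<partial>count_space (G\<^sup>* `` {x})) \<le> ennreal \<eta>"
      if xz: "(x, z) \<in> G" for z
    proof -
      have "(\<integral>\<^sup>+y. ennreal \<bar>p (x, y) - p (z, y)\<bar> \<partial>count_space (G\<^sup>* `` {x})) =
          ennreal (\<Sum>\<^sub>\<infinity>y\<in>G\<^sup>* `` {x}. \<bar>p (x, y) - p (z, y)\<bar>)"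
      proof (rule nn_integral_count_space_eq_infsum)
        have zx: "(x, z) \<in> G\<^sup>*" using xz by auto
        show "finite (reach R `` {x} \<union> reach R `` {z})" using finite_reach by simp
        show "reach R `` {x} \<union> reach R `` {z} \<subseteq> G\<^sup>* `` {x}" using reach_E E_trans[OF zx] by auto
        show "\<bar>p (x, y) - p (z, y)\<bar> = 0" if "y \<in> G\<^sup>* `` {x} - (reach R `` {x} \<union> reach R `` {z})" for y
        proof -
          have "(x, y) \<in> G\<^sup>*" "(z, y) \<in> G\<^sup>*" using that E_trans[OF E_sym[OF zx]] by auto
          moreover have "(x, y) \<notin> reach R" "(z, y) \<notin> reach R" using that by auto
          ultimately have "p (x, y) = 0" "p (z, y) = 0" using supp by blast+
          then show ?thesis by simp
        qed
      qed simp
      then show ?thesis using grad[OF xz] by (simp add: ennreal_leI)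
    qed
    have "(\<integral>\<^sup>+y. g x y \<partial>count_space (G\<^sup>* `` {x})) =
        (\<Sum>z\<in>G `` {x} \<inter> A. \<integral>\<^sup>+y. ennreal \<bar>p (x, y) - p (z, y)\<bar> \<partial>count_space (G\<^sup>* `` {x}))"
      unfolding g by (rule nn_integral_sum) simp
    also have "\<dots> \<le> (\<Sum>z\<in>G `` {x} \<inter> A. ennreal \<eta>)" by (rule sum_mono) (use edge in auto)
    also have "\<dots> = ennreal (real (card (G `` {x} \<inter> A)) * \<eta>)"
      using \<open>0 \<le> \<eta>\<close> by (simp add: ennreal_mult ennreal_of_nat_eq_real_of_nat)
    also have "\<dots> \<le> ennreal (real D * \<eta>)"
      using card_nbrs[of x] card_mono[OF finite_nbrs[of x], of "G `` {x} \<inter> A"] \<open>0 \<le> \<eta>\<close>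
      by (intro ennreal_leI mult_right_mono) auto
    finally show ?thesis unfolding \<psi>_def by (simp add: nn_integral_cmult mult_left_mono)
  qed
  have compare: "ennreal \<delta> * (\<integral>\<^sup>+x. \<phi> x y \<partial>count_space (G\<^sup>* `` {y})) \<le> (\<integral>\<^sup>+x. \<psi> x y \<partial>count_space (G\<^sup>* `` {y}))" for y
  proof -
    define S where "S = A \<inter> reach R `` {y}"
    have S: "finite S" "S \<subseteq> A" "S \<subseteq> G\<^sup>* `` {y}" unfolding S_def using finite_reach reach_E by auto
    \<comment> \<open>\<open>p\<close> is arbitrary between different components, while the coarea
      lemma wants \<open>q\<close> to vanish on all of \<open>A - S\<close>.\<close>
    define q where "q = (\<lambda>x. if (x, y) \<in> G\<^sup>* then p (x, y) else 0)"
    have qE: "q x = p (x, y)" if "(x, y) \<in> G\<^sup>*" for x using that by (simp add: q_def)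
    have SE: "(x, y) \<in> G\<^sup>*" if "x \<in> S" for x using that S(3) E_sym by blast
    have out: "p (x, y) = 0" if "x \<in> A" "x \<notin> S" "(x, y) \<in> G\<^sup>*" for x
      using that supp[of x y] reach_sym[of x y R] unfolding S_def by blast
    have "(\<integral>\<^sup>+x. \<phi> x y \<partial>count_space (G\<^sup>* `` {y})) = (\<Sum>x\<in>S. \<phi> x y)"
    proof (rule nn_integral_count_space')
      show "\<phi> x y = 0" if "x \<in> G\<^sup>* `` {y}" "x \<notin> S" for x
      proof -
        have "(x, y) \<in> G\<^sup>*" using that(1) E_sym by blast
        then show ?thesis using that(2) out[of x] by (auto simp: \<phi>_def indicator_def)
      qed
    qed (use S in auto)
    also have "\<dots> = (\<Sum>x\<in>S. ennreal (q x))"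
      using S(2) SE by (intro sum.cong) (auto simp: \<phi>_def qE)
    also have "ennreal \<delta> * \<dots> \<le> (\<Sum>x\<in>S. \<Sum>z\<in>G `` {x} \<inter> A. ennreal \<bar>q x - q z\<bar>)"
    proof (rule isoperimetric_coarea)
      show "q x = 0" if "x \<in> A - S" for x
        using that out unfolding q_def by auto
      show "\<delta> * real (card F) \<le> real (card (bdry G A F))" if "F \<subseteq> S" "F \<noteq> {}" for F
        using iso that unfolding S_def by blast
    qed (use S SE nonneg finite_nbrs \<open>0 \<le> \<delta>\<close> in \<open>auto simp: q_def\<close>)
    also have "\<dots> = (\<Sum>x\<in>S. \<psi> x y)"
    proof (rule sum.cong)
      fix x assume x: "x \<in> S"
      have "q z = p (z, y)" if "(x, z) \<in> G" for z
        using E_trans[OF E_sym[OF r_into_rtrancl[OF that]] SE[OF x]] by (rule qE)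
      then show "(\<Sum>z\<in>G `` {x} \<inter> A. ennreal \<bar>q x - q z\<bar>) = \<psi> x y"
        using S(2) x SE[OF x] by (auto simp: \<psi>_def g qE intro!: sum.cong)
    qed simp
    also have "\<dots> = (\<integral>\<^sup>+x. \<psi> x y * indicator S x \<partial>count_space (G\<^sup>* `` {y}))"
      using S by (subst nn_integral_count_space'[of S]) (auto intro!: sum.cong)
    also have "\<dots> \<le> (\<integral>\<^sup>+x. \<psi> x y \<partial>count_space (G\<^sup>* `` {y}))"
      by (intro nn_integral_mono) (auto simp: indicator_def)
    finally show ?thesis .
  qed
  have "ennreal \<delta> * emeasure \<mu> A = ennreal \<delta> * (\<integral>\<^sup>+x. \<integral>\<^sup>+y. \<phi> x y \<partial>count_space (G\<^sup>* `` {x}) \<partial>\<mu>)"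
    unfolding \<phi>_out by (subst nn_integral_indicator) simp_all
  also have "\<dots> = ennreal \<delta> * (\<integral>\<^sup>+y. \<integral>\<^sup>+x. \<phi> x y \<partial>count_space (G\<^sup>* `` {y}) \<partial>\<mu>)"
    by (subst mass_transport[OF \<mu>]) simp_all
  also have "\<dots> = (\<integral>\<^sup>+y. ennreal \<delta> * (\<integral>\<^sup>+x. \<phi> x y \<partial>count_space (G\<^sup>* `` {y})) \<partial>\<mu>)"
  proof (rule nn_integral_cmult[symmetric])
    have "(\<lambda>y. \<integral>\<^sup>+x. \<phi> x y \<partial>count_space (G\<^sup>* `` {y})) \<in> borel_measurable borel"
      by (rule class_integral_measurable) (simp_all add: \<phi>_def)
    then show "(\<lambda>y. \<integral>\<^sup>+x. \<phi> x y \<partial>count_space (G\<^sup>* `` {y})) \<in> borel_measurable \<mu>"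
      by (simp cong: measurable_cong_sets add: sets)
  qed
  also have "\<dots> \<le> (\<integral>\<^sup>+y. (\<integral>\<^sup>+x. \<psi> x y \<partial>count_space (G\<^sup>* `` {y})) \<partial>\<mu>)"
    by (intro nn_integral_mono compare)
  also have "\<dots> = (\<integral>\<^sup>+x. \<integral>\<^sup>+y. \<psi> x y \<partial>count_space (G\<^sup>* `` {x}) \<partial>\<mu>)"
    by (rule mass_transport[OF \<mu>, symmetric]) simp
  also have "\<dots> \<le> (\<integral>\<^sup>+x. indicator A x * ennreal (real D * \<eta>) \<partial>\<mu>)"
    by (intro nn_integral_mono \<psi>_out)
  also have "\<dots> = ennreal (real D * \<eta>) * emeasure \<mu> A"
    by (subst nn_integral_multc) (simp_all add: mult.commute)
  finally have "ennreal \<delta> * emeasure \<mu> A \<le> ennreal (real D * \<eta>) * emeasure \<mu> A" .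
  then have "\<delta> * measure \<mu> A \<le> real D * \<eta> * measure \<mu> A"
    using \<open>0 \<le> \<delta>\<close> \<open>0 \<le> \<eta>\<close> by (simp add: emeasure_eq_measure flip: ennreal_mult)
  then have "measure \<mu> A = 0"
    using \<open>real D * \<eta> < \<delta>\<close> measure_nonneg[of \<mu> A] by (smt (verit) mult_le_cancel_right)
  then show ?thesis by (simp add: emeasure_eq_measure)
qed

end

section \<open>Tilings by sets with small boundary\<close>

context borel_graph_enumeration
begin

text \<open>\<open>c\<close> codes a finite set of indices. Every finite subset of the component of
  \<open>b\<close> is a piece at \<open>b\<close>, so countably many shapes suffice, each moved by
  Borel functions of \<open>b\<close>.\<close>

definition piece :: "nat \<Rightarrow> 'a \<Rightarrow> 'a set" where
  "piece c b = (\<lambda>k. e k b) ` set_decode c"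

lemma finite_piece: "finite (piece c b)"
  by (simp add: piece_def)

lemma piece_E: "x \<in> piece c b \<Longrightarrow> (b, x) \<in> G\<^sup>*"
  by (auto simp: piece_def)

lemma mem_bdry_piece:
  "x \<in> bdry G A (piece c b) \<longleftrightarrow> (\<exists>k\<in>set_decode c. e k b = x) \<and>
     (\<exists>m. (x, e m x) \<in> G \<and> e m x \<in> A \<and> (\<forall>l\<in>set_decode c. e m x \<noteq> e l b))"
proof -
  have "\<exists>m. y = e m x" if "(x, y) \<in> G" for y
    using r_into_rtrancl[OF that] E_iff by blast
  then show ?thesis unfolding bdry_def piece_def by fastforce
qed

text \<open>Injectivity makes the size of a piece depend on \<open>c\<close> only and turns boundary
  counts into finite sums of Borel conditions on \<open>b\<close>. No candidate is lost, since a
  finite set in the component of \<open>b\<close> has an injective code.\<close>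

definition good_bases :: "nat \<Rightarrow> real \<Rightarrow> 'a set \<Rightarrow> nat \<Rightarrow> 'a set" where
  "good_bases R \<delta> A c = {b. piece c b \<subseteq> A \<inter> reach R `` {b} \<and> inj_on (\<lambda>k. e k b) (set_decode c) \<and>
     real (card (bdry G A (piece c b))) \<le> \<delta> * real (card (piece c b))}"

lemma good_bases_sets[measurable]:
  assumes [measurable]: "A \<in> sets borel"
  shows "good_bases R \<delta> A c \<in> sets borel"
proof -
  define I where "I = set_decode c"
  have [simp]: "finite I" by (simp add: I_def)
  define Q where "Q = (\<lambda>k b. \<exists>m. (e k b, e m (e k b)) \<in> G \<and> e m (e k b) \<in> A \<and> (\<forall>l\<in>I. e m (e k b) \<noteq> e l b))"
  have card: "card (bdry G A (piece c b)) = (\<Sum>k\<in>I. if Q k b then 1 else 0)" "card (piece c b) = card I"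
    if inj: "inj_on (\<lambda>k. e k b) I" for b
  proof -
    have "bdry G A (piece c b) = (\<lambda>k. e k b) ` {k \<in> I. Q k b}"
      unfolding set_eq_iff mem_bdry_piece Q_def I_def image_iff by blast
    then have "card (bdry G A (piece c b)) = card {k \<in> I. Q k b}"
      using inj_on_subset[OF inj, of "{k \<in> I. Q k b}"] by (simp add: card_image subset_eq)
    also have "\<dots> = (\<Sum>k\<in>I. if Q k b then 1 else 0)"
      by (simp add: sum.If_cases Int_def)
    finally show "card (bdry G A (piece c b)) = (\<Sum>k\<in>I. if Q k b then 1 else 0)" .
    show "card (piece c b) = card I" using inj by (simp add: piece_def I_def card_image)
  qed
  have "good_bases R \<delta> A c = {b \<in> space borel. (\<forall>k\<in>I. e k b \<in> A \<and> (b, e k b) \<in> reach R) \<and>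
      (\<forall>k\<in>I. \<forall>l\<in>I. e k b = e l b \<longrightarrow> k = l) \<and>
      (\<Sum>k\<in>I. if Q k b then 1 else 0) \<le> \<delta> * real (card I)}"
  proof (intro set_eqI)
    fix b
    have real_sum: "real (\<Sum>k\<in>I. if Q k b then 1 else 0) = (\<Sum>k\<in>I. if Q k b then 1 else 0)"
      by (simp add: if_distrib cong: if_cong)
    have "piece c b \<subseteq> A \<inter> reach R `` {b} \<longleftrightarrow> (\<forall>k\<in>I. e k b \<in> A \<and> (b, e k b) \<in> reach R)"
      by (auto simp: piece_def I_def)
    moreover have "real (card (bdry G A (piece c b))) \<le> \<delta> * real (card (piece c b)) \<longleftrightarrow>
        (\<Sum>k\<in>I. if Q k b then 1 else 0) \<le> \<delta> * real (card I)" if "inj_on (\<lambda>k. e k b) I"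
      unfolding card[OF that] real_sum ..
    ultimately have "b \<in> good_bases R \<delta> A c \<longleftrightarrow> (\<forall>k\<in>I. e k b \<in> A \<and> (b, e k b) \<in> reach R) \<and>
        inj_on (\<lambda>k. e k b) I \<and> (\<Sum>k\<in>I. if Q k b then 1 else 0) \<le> \<delta> * real (card I)"
      unfolding good_bases_def mem_Collect_eq I_def[symmetric] by blast
    then show "b \<in> good_bases R \<delta> A c \<longleftrightarrow> b \<in> {b \<in> space borel.
        (\<forall>k\<in>I. e k b \<in> A \<and> (b, e k b) \<in> reach R) \<and> (\<forall>k\<in>I. \<forall>l\<in>I. e k b = e l b \<longrightarrow> k = l) \<and>
        (\<Sum>k\<in>I. if Q k b then 1 else 0) \<le> \<delta> * real (card I)}"
      by (simp add: inj_on_def)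
  qed
  also have "\<dots> \<in> sets borel" unfolding Q_def by measurable
  finally show ?thesis .
qed

lemma piece_graph_sets[measurable]:
  assumes [measurable]: "B \<in> sets borel"
  shows "{(b, x). b \<in> B \<and> x \<in> piece c b} \<in> sets (borel \<Otimes>\<^sub>M borel)"
proof -
  have "{(b, x). b \<in> B \<and> x \<in> piece c b} =
      {w \<in> space (borel \<Otimes>\<^sub>M borel). fst w \<in> B \<and> (\<exists>k\<in>set_decode c. e k (fst w) = snd w)}"
    by (auto simp: piece_def space_pair_measure)
  also have "\<dots> \<in> sets (borel \<Otimes>\<^sub>M borel)" by measurable
  finally show ?thesis .
qed

lemma bdry_graph_sets[measurable]:
  assumes [measurable]: "B \<in> sets borel" "A \<in> sets borel"
  shows "{(b, x). b \<in> B \<and> x \<in> bdry G A (piece c b)} \<in> sets (borel \<Otimes>\<^sub>M borel)"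
proof -
  have "{(b, x). b \<in> B \<and> x \<in> bdry G A (piece c b)} =
      {w \<in> space (borel \<Otimes>\<^sub>M borel). fst w \<in> B \<and> (\<exists>k\<in>set_decode c. e k (fst w) = snd w) \<and>
       (\<exists>m. (snd w, e m (snd w)) \<in> G \<and> e m (snd w) \<in> A \<and> (\<forall>l\<in>set_decode c. e m (snd w) \<noteq> e l (fst w)))}"
    by (auto simp: mem_bdry_piece space_pair_measure)
  also have "\<dots> \<in> sets (borel \<Otimes>\<^sub>M borel)" by measurable
  finally show ?thesis .
qed

text \<open>Projections of Borel sets are in general only analytic; here the partners of
  \<open>x\<close> lie in its component, so countably many tests suffice.\<close>

lemma saturation_sets:
  assumes T[measurable]: "T \<in> sets (borel \<Otimes>\<^sub>M borel)" and "T \<subseteq> G\<^sup>*"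
  shows "T `` UNIV \<in> sets borel"
proof -
  have "T `` UNIV = {x \<in> space borel. \<exists>m. (e m x, x) \<in> T}"
  proof -
    have "\<exists>m. b = e m x" if "(b, x) \<in> T" for b x
      using that assms(2) E_sym E_iff by blast
    then show ?thesis by fastforce
  qed
  also have "\<dots> \<in> sets borel" by measurable
  finally show ?thesis .
qed

text \<open>If each base sends mass 1 to every boundary point of its piece, each such point receives
  at least 1. If it sends mass 1 to every point of the piece, disjointness lets each point receive
  at most 1. The amounts sent compare by the factor \<delta>.\<close>

lemma measure_bdry_pieces:
  assumes \<mu>: "invariant_measure (G\<^sup>*) \<mu>"
    and [measurable]: "A \<in> sets borel" "B \<in> sets borel"
    and disj: "\<And>b b'. b \<in> B \<Longrightarrow> b' \<in> B \<Longrightarrow> b \<noteq> b' \<Longrightarrow> piece c b \<inter> piece c b' = {}"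
    and "0 \<le> \<delta>" and card: "\<And>b. b \<in> B \<Longrightarrow> real (card (bdry G A (piece c b))) \<le> \<delta> * real (card (piece c b))"
  shows "emeasure \<mu> (\<Union>b\<in>B. bdry G A (piece c b)) \<le> ennreal \<delta> * emeasure \<mu> (\<Union>b\<in>B. piece c b)"
proof -
  have sets[measurable_cong]: "sets \<mu> = sets borel" using \<mu> by (simp add: invariant_measure_def)
  define T1 where "T1 = {(b, x). b \<in> B \<and> x \<in> bdry G A (piece c b)}"
  define T2 where "T2 = {(b, x). b \<in> B \<and> x \<in> piece c b}"
  have [measurable]: "T1 \<in> sets (borel \<Otimes>\<^sub>M borel)" "T2 \<in> sets (borel \<Otimes>\<^sub>M borel)"
    unfolding T1_def T2_def by measurable
  have bp: "bdry G A (piece c b) \<subseteq> piece c b" for b unfolding bdry_def by auto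
  have T1E: "T1 \<subseteq> G\<^sup>*" and T2E: "T2 \<subseteq> G\<^sup>*"
    unfolding T1_def T2_def by (auto dest!: subsetD[OF bp] piece_E)
  have U: "(\<Union>b\<in>B. bdry G A (piece c b)) = T1 `` UNIV" "(\<Union>b\<in>B. piece c b) = T2 `` UNIV"
    unfolding T1_def T2_def by auto
  have S1: "T1 `` UNIV \<in> sets \<mu>" using saturation_sets[of T1] T1E sets by simp
  have S2: "T2 `` UNIV \<in> sets \<mu>" using saturation_sets[of T2] T2E sets by simp
  have out: "(\<integral>\<^sup>+x. indicator T (b, x) \<partial>count_space (G\<^sup>* `` {b})) = ennreal (real (card (T `` {b})))"
    if "T \<subseteq> G\<^sup>*" "finite (T `` {b})" for T b
  proof -
    have "(\<integral>\<^sup>+x. indicator T (b, x) \<partial>count_space (G\<^sup>* `` {b})) = (\<Sum>x\<in>T `` {b}. indicator T (b, x))"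
      by (rule nn_integral_count_space') (use that in auto)
    also have "\<dots> = (\<Sum>x\<in>T `` {b}. 1)" by (rule sum.cong) auto
    finally show ?thesis by (simp add: ennreal_of_nat_eq_real_of_nat)
  qed
  have T1_fibre: "T1 `` {b} = (if b \<in> B then bdry G A (piece c b) else {})"
    and T2_fibre: "T2 `` {b} = (if b \<in> B then piece c b else {})" for b
    unfolding T1_def T2_def by auto
  have F1: "finite (T1 `` {b})" and F2: "finite (T2 `` {b})" for b
    using finite_subset[OF bp finite_piece, of b] finite_piece[of c b]
    by (simp_all add: T1_fibre T2_fibre)
  have "emeasure \<mu> (T1 `` UNIV) = (\<integral>\<^sup>+x. indicator (T1 `` UNIV) x \<partial>\<mu>)" using S1 by simp
  also have "\<dots> \<le> (\<integral>\<^sup>+x. \<integral>\<^sup>+b. indicator T1 (b, x) \<partial>count_space (G\<^sup>* `` {x}) \<partial>\<mu>)"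
  proof (rule nn_integral_mono)
    fix x
    show "indicator (T1 `` UNIV) x \<le> (\<integral>\<^sup>+b. indicator T1 (b, x) \<partial>count_space (G\<^sup>* `` {x}) :: ennreal)"
    proof (cases "x \<in> T1 `` UNIV")
      case True
      then obtain b where b: "(b, x) \<in> T1" by auto
      then have "b \<in> G\<^sup>* `` {x}" using T1E E_sym by blast
      then show ?thesis using nn_integral_ge_point[of b "G\<^sup>* `` {x}" "\<lambda>b. indicator T1 (b, x)"] b True by simp
    qed simp
  qed
  also have "\<dots> = (\<integral>\<^sup>+b. \<integral>\<^sup>+x. indicator T1 (b, x) \<partial>count_space (G\<^sup>* `` {b}) \<partial>\<mu>)"
    by (rule mass_transport[OF \<mu>, symmetric]) simp
  also have "\<dots> \<le> (\<integral>\<^sup>+b. ennreal \<delta> * \<integral>\<^sup>+x. indicator T2 (b, x) \<partial>count_space (G\<^sup>* `` {b}) \<partial>\<mu>)"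
  proof (rule nn_integral_mono)
    fix b
    have "real (card (T1 `` {b})) \<le> \<delta> * real (card (T2 `` {b}))"
      using card \<open>0 \<le> \<delta>\<close> by (simp add: T1_fibre T2_fibre)
    then show "(\<integral>\<^sup>+x. indicator T1 (b, x) \<partial>count_space (G\<^sup>* `` {b})) \<le>
        ennreal \<delta> * \<integral>\<^sup>+x. indicator T2 (b, x) \<partial>count_space (G\<^sup>* `` {b})"
      unfolding out[OF T1E F1] out[OF T2E F2] using \<open>0 \<le> \<delta>\<close>
      by (simp add: ennreal_leI flip: ennreal_mult)
  qed
  also have "\<dots> = ennreal \<delta> * (\<integral>\<^sup>+b. \<integral>\<^sup>+x. indicator T2 (b, x) \<partial>count_space (G\<^sup>* `` {b}) \<partial>\<mu>)"
  proof (rule nn_integral_cmult)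
    have "(\<lambda>b. \<integral>\<^sup>+x. indicator T2 (b, x) \<partial>count_space (G\<^sup>* `` {b})) \<in> borel_measurable borel"
      by (rule class_integral_measurable) simp_all
    then show "(\<lambda>b. \<integral>\<^sup>+x. indicator T2 (b, x) \<partial>count_space (G\<^sup>* `` {b})) \<in> borel_measurable \<mu>"
      by (simp cong: measurable_cong_sets add: sets)
  qed
  also have "\<dots> = ennreal \<delta> * (\<integral>\<^sup>+x. \<integral>\<^sup>+b. indicator T2 (b, x) \<partial>count_space (G\<^sup>* `` {x}) \<partial>\<mu>)"
    by (subst mass_transport[OF \<mu>]) simp_all
  also have "\<dots> \<le> ennreal \<delta> * (\<integral>\<^sup>+x. indicator (T2 `` UNIV) x \<partial>\<mu>)"
  proof (intro mult_left_mono nn_integral_mono)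
    fix x
    show "(\<integral>\<^sup>+b. indicator T2 (b, x) \<partial>count_space (G\<^sup>* `` {x})) \<le> (indicator (T2 `` UNIV) x :: ennreal)"
    proof (cases "x \<in> T2 `` UNIV")
      case True
      then obtain b where b: "(b, x) \<in> T2" by auto
      have "b' = b" if "(b', x) \<in> T2" for b'
        using b that disj unfolding T2_def by blast
      then have "indicator T2 (b', x) = (0 :: ennreal)" if "b' \<noteq> b" for b'
        using that by (auto simp: indicator_def)
      moreover have "b \<in> G\<^sup>* `` {x}" using b T2E E_sym by blast
      ultimately have "(\<integral>\<^sup>+b. indicator T2 (b, x) \<partial>count_space (G\<^sup>* `` {x})) = (\<Sum>b\<in>{b}. indicator T2 (b, x) :: ennreal)"
        by (intro nn_integral_count_space') auto
      then show ?thesis using b True by simp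
    next
      case False
      then have "indicator T2 (b, x) = (0 :: ennreal)" for b by (auto simp: indicator_def)
      then show ?thesis by simp
    qed
  qed simp
  also have "\<dots> = ennreal \<delta> * emeasure \<mu> (T2 `` UNIV)" using S2 by simp
  finally show ?thesis unfolding U .
qed

end

text \<open>One run of the removal: stage \<open>t\<close> takes away, all at once, pieces of the
  single shape \<open>c t\<close>. \<open>maximal\<close> supplies the isoperimetric hypothesis of
  \<open>null_set_without_foelner_subsets\<close>.\<close>

locale foelner_tiling = borel_graph_enumeration G e e' D
  for G :: "('a::polish_space \<times> 'a) set" and e e' D +
  fixes R :: nat and \<delta> :: real and A B :: "nat \<Rightarrow> 'a set" and c :: "nat \<Rightarrow> nat"
  assumes \<delta>_nonneg: "0 \<le> \<delta>"
    and A_0: "A 0 = UNIV" and A_Suc: "\<And>t. A (Suc t) = A t - (\<Union>b\<in>B t. piece (c t) b)"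
    and A_sets[measurable]: "\<And>t. A t \<in> sets borel" and B_sets[measurable]: "\<And>t. B t \<in> sets borel"
    and B_good: "\<And>t. B t \<subseteq> good_bases R \<delta> (A t) (c t)"
    and B_disj: "\<And>t b b'. b \<in> B t \<Longrightarrow> b' \<in> B t \<Longrightarrow> b \<noteq> b' \<Longrightarrow> piece (c t) b \<inter> piece (c t) b' = {}"
    and maximal: "\<And>b F. F \<subseteq> (\<Inter>t. A t) \<inter> reach R `` {b} \<Longrightarrow> F \<noteq> {} \<Longrightarrow>
        \<delta> * real (card F) < real (card (bdry G (\<Inter>t. A t) F))"

text \<open>Each code of a shape and a separated set of base points is used at infinitely many stages,
  so a set F in the final remainder with small boundary would have been removed: its boundary relative
  to the remainder is already attained at some finite stage.\<close>

lemma (in borel_graph_enumeration) foelner_tiling_exists: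
  assumes "0 \<le> \<delta>"
  obtains A B c where "foelner_tiling G e e' D R \<delta> A B c"
proof -
  \<comment> \<open>\<open>R + R\<close> because pieces inside the \<open>R\<close>-balls of their
    bases can meet only if the bases are within \<open>2 R\<close>.\<close>
  obtain W :: "nat \<Rightarrow> 'a set" where [measurable]: "\<And>i. W i \<in> sets borel" and W: "\<And>x. \<exists>i. x \<in> W i"
    and sep: "\<And>i x y. x \<in> W i \<Longrightarrow> y \<in> W i \<Longrightarrow> (x, y) \<in> reach (R + R) \<Longrightarrow> x = y"
    using separated_cover[of "R + R"] by metis
  \<comment> \<open>\<open>t\<close> codes a shape, a colour and a free counter; the counter makes
    every pair of shape and colour recur at arbitrarily late stages.\<close>
  define c where "c = (\<lambda>t. fst (prod_decode t))"
  define w where "w = (\<lambda>t. W (fst (prod_decode (snd (prod_decode t)))))"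
  define A where "A = rec_nat UNIV (\<lambda>t S. S - (\<Union>b\<in>w t \<inter> good_bases R \<delta> S (c t). piece (c t) b))"
  define B where "B = (\<lambda>t. w t \<inter> good_bases R \<delta> (A t) (c t))"
  have A_0: "A 0 = UNIV" and A_Suc: "A (Suc t) = A t - (\<Union>b\<in>B t. piece (c t) b)" for t
    by (simp_all add: A_def B_def)
  have [measurable]: "w t \<in> sets borel" for t by (simp add: w_def)
  have A_sets[measurable]: "A t \<in> sets borel" for t
  proof (induction t)
    case (Suc t)
    note [measurable] = Suc
    have [measurable]: "B t \<in> sets borel" unfolding B_def by measurable
    define T where "T = {(b, x). b \<in> B t \<and> x \<in> piece (c t) b}"
    have "T `` UNIV \<in> sets borel"
      unfolding T_def by (rule saturation_sets) (use piece_E in auto)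
    moreover have "(\<Union>b\<in>B t. piece (c t) b) = T `` UNIV" unfolding T_def by auto
    ultimately show ?case using Suc by (simp add: A_Suc)
  qed (simp add: A_0)
  have B_sets: "B t \<in> sets borel" for t unfolding B_def by measurable
  have B_disj: "piece (c t) b \<inter> piece (c t) b' = {}" if "b \<in> B t" "b' \<in> B t" "b \<noteq> b'" for t b b'
  proof (rule ccontr)
    assume "\<not> ?thesis"
    then obtain x where "x \<in> piece (c t) b" "x \<in> piece (c t) b'" by blast
    then have "(b, x) \<in> reach R" "(b', x) \<in> reach R"
      using that unfolding B_def good_bases_def by auto
    then have "(b, b') \<in> reach (R + R)" using reach_sym reach_trans by blast
    then show False using sep that unfolding B_def w_def by blast
  qed
  have decr: "A t \<subseteq> A s" if "s \<le> t" for s t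
    using lift_Suc_antimono_le[of A s t] that A_Suc by blast
  have maximal: "\<delta> * real (card F) < real (card (bdry G (\<Inter>t. A t) F))"
    if F: "F \<subseteq> (\<Inter>t. A t) \<inter> reach R `` {b}" "F \<noteq> {}" for b F
  proof (rule ccontr)
    assume small: "\<not> ?thesis"
    have "finite F" using F finite_reach finite_subset by blast
    have "F \<subseteq> G\<^sup>* `` {b}" using F(1) reach_E by blast
    then have "F \<subseteq> range (\<lambda>k. e k b)" unfolding range_e .
    then obtain I where I: "inj_on (\<lambda>k. e k b) I" "F = (\<lambda>k. e k b) ` I"
      unfolding subset_image_inj by blast
    then have "finite I" using \<open>finite F\<close> finite_imageD by blast
    obtain i where i: "b \<in> W i" using W by blast
    have piece: "piece (set_encode I) b = F"
      using I \<open>finite I\<close> by (simp add: piece_def)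
    \<comment> \<open>Relative to a larger \<open>A t\<close> the boundary of \<open>F\<close> may
      be larger, so the stage must be late: the finitely many neighbours of \<open>F\<close> have
      all settled by stage \<open>s\<close>, and the counter in \<open>t\<close> forces
      \<open>s \<le> t\<close>.\<close>
    have "\<forall>\<^sub>F t in sequentially. y \<in> A t \<longleftrightarrow> y \<in> (\<Inter>t. A t)" for y
    proof (cases "y \<in> (\<Inter>t. A t)")
      case False
      then obtain s where "y \<notin> A s" by blast
      then have "\<forall>t\<ge>s. y \<notin> A t" using decr by blast
      then show ?thesis unfolding eventually_sequentially using False by blast
    qed auto
    then have "\<forall>\<^sub>F t in sequentially. \<forall>y\<in>(\<Union>x\<in>F. G `` {x}). y \<in> A t \<longleftrightarrow> y \<in> (\<Inter>t. A t)"
      using \<open>finite F\<close> finite_nbrs by (intro eventually_ball_finite) auto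
    then obtain s where s: "\<And>t y. t \<ge> s \<Longrightarrow> y \<in> (\<Union>x\<in>F. G `` {x}) \<Longrightarrow> y \<in> A t \<longleftrightarrow> y \<in> (\<Inter>t. A t)"
      unfolding eventually_sequentially by blast
    define t where "t = prod_encode (set_encode I, prod_encode (i, s))"
    have "s \<le> t" unfolding t_def using le_prod_encode_2 le_trans by blast
    have ct: "c t = set_encode I" and wt: "w t = W i" by (simp_all add: t_def c_def w_def)
    have "bdry G (A t) F = bdry G (\<Inter>t. A t) F"
      unfolding bdry_def using s[OF \<open>s \<le> t\<close>] by blast
    then have "b \<in> B t"
      using small i F(1) I(1) \<open>finite I\<close> piece by (auto simp: B_def good_bases_def ct wt)
    then have "F \<inter> A (Suc t) = {}" using piece by (auto simp: A_Suc ct)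
    moreover have "F \<subseteq> A (Suc t)" using F(1) by blast
    ultimately show False using F(2) by blast
  qed
  have "foelner_tiling G e e' D R \<delta> A B c"
    by (unfold_locales; (fact assms A_0 A_Suc A_sets B_sets B_disj maximal)?) (auto simp: B_def)
  then show thesis by (rule that)
qed

section \<open>The partition given by a tiling and its exceptional set\<close>

context foelner_tiling
begin

definition tile_rel :: "('a \<times> 'a) set" where
  "tile_rel = {(x, y). x = y \<or> (\<exists>t. \<exists>b\<in>B t. x \<in> piece (c t) b \<and> y \<in> piece (c t) b)}"

text \<open>The whole remainder is included because its points are singleton classes, so no edge at
  them lies in a class.\<close>

definition tile_bdry :: "'a set" where
  "tile_bdry = (\<Inter>t. A t) \<union> (\<Union>t. \<Union>b\<in>B t. bdry G (A t) (piece (c t) b))"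

lemma A_decr: "s \<le> t \<Longrightarrow> A t \<subseteq> A s"
  using lift_Suc_antimono_le[of A s t] A_Suc by blast

lemma piece_A: "b \<in> B t \<Longrightarrow> piece (c t) b \<subseteq> A t - A (Suc t)"
  using B_good[of t] unfolding A_Suc good_bases_def by blast

lemma piece_reach: "b \<in> B t \<Longrightarrow> x \<in> piece (c t) b \<Longrightarrow> (b, x) \<in> reach R"
  using B_good[of t] unfolding good_bases_def by blast

lemma layers_disjoint:
  assumes "x \<in> A s - A (Suc s)" "x \<in> A t - A (Suc t)"
  shows "s = t"
proof (rule ccontr)
  assume "s \<noteq> t"
  then have "Suc s \<le> t \<or> Suc t \<le> s" by auto
  then show False using assms A_decr by blast
qed

lemma piece_unique:
  assumes "b \<in> B s" "x \<in> piece (c s) b" "b' \<in> B t" "x \<in> piece (c t) b'"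
  shows "s = t \<and> b = b'"
proof -
  have "s = t" using assms piece_A layers_disjoint by blast
  then show ?thesis using assms B_disj by blast
qed

lemma tile_rel_equiv: "equiv UNIV tile_rel"
proof (rule equivI)
  show "refl_on UNIV tile_rel" by (auto simp: refl_on_def tile_rel_def)
  show "sym tile_rel" by (auto simp: sym_def tile_rel_def)
  show "trans tile_rel"
  proof (rule transI)
    fix x y z assume xy: "(x, y) \<in> tile_rel" and yz: "(y, z) \<in> tile_rel"
    show "(x, z) \<in> tile_rel"
    proof (cases "x = y \<or> y = z")
      case True
      then show ?thesis using xy yz by auto
    next
      case False
      then obtain s b t b' where *: "b \<in> B s" "x \<in> piece (c s) b" "y \<in> piece (c s) b"
        "b' \<in> B t" "y \<in> piece (c t) b'" "z \<in> piece (c t) b'"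
        using xy yz unfolding tile_rel_def by blast
      then show ?thesis using piece_unique[OF *(1,3,4,5)] unfolding tile_rel_def by blast
    qed
  qed
qed simp

lemma tile_rel_reach: "tile_rel \<subseteq> reach (R + R)"
proof -
  have "(x, x) \<in> reach n" for x n unfolding reach_def by (auto intro!: bexI[of _ 0])
  moreover have "(x, y) \<in> reach (R + R)" if "b \<in> B t" "x \<in> piece (c t) b" "y \<in> piece (c t) b" for x y b t
    by (rule reach_trans[OF reach_sym[OF piece_reach[OF that(1,2)]] piece_reach[OF that(1,3)]])
  ultimately show ?thesis unfolding tile_rel_def by auto
qed

lemma tile_rel_sets: "tile_rel \<in> sets (borel \<Otimes>\<^sub>M borel)"
proof -
  define T where "T = (\<lambda>t. {(b, x). b \<in> B t \<and> x \<in> piece (c t) b})"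
  have [measurable]: "T t \<in> sets (borel \<Otimes>\<^sub>M borel)" for t unfolding T_def by measurable
  have "tile_rel = {w \<in> space (borel \<Otimes>\<^sub>M borel). fst w = snd w \<or>
      (\<exists>t m. (e m (fst w), fst w) \<in> T t \<and> (e m (fst w), snd w) \<in> T t)}"
  proof -
    have "\<exists>m. b = e m x" if "x \<in> piece (c t) b" for b x t
      using piece_E[OF that] E_sym E_iff by blast
    then show ?thesis unfolding tile_rel_def T_def by (fastforce simp: space_pair_measure)
  qed
  also have "\<dots> \<in> sets (borel \<Otimes>\<^sub>M borel)" by measurable
  finally show ?thesis .
qed

lemma bdry_layer_sets: "(\<Union>b\<in>B t. bdry G (A t) (piece (c t) b)) \<in> sets borel"
proof -
  define T where "T = {(b, x). b \<in> B t \<and> x \<in> bdry G (A t) (piece (c t) b)}"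
  have "T \<in> sets (borel \<Otimes>\<^sub>M borel)" unfolding T_def by measurable
  moreover have "T \<subseteq> G\<^sup>*" unfolding T_def bdry_def using piece_E by auto
  ultimately have "T `` UNIV \<in> sets borel" by (rule saturation_sets)
  moreover have "(\<Union>b\<in>B t. bdry G (A t) (piece (c t) b)) = T `` UNIV" unfolding T_def by auto
  ultimately show ?thesis by simp
qed

lemma remainder_sets: "(\<Inter>t. A t) \<in> sets borel"
  by measurable

lemma tile_bdry_sets: "tile_bdry \<in> sets borel"
  unfolding tile_bdry_def by (intro sets.Un remainder_sets sets.countable_UN) (auto intro: bdry_layer_sets)

text \<open>Of two removed ends, the one removed no later than the other still sees it in its
  \<open>A s\<close>; an edge leaving the piece would make this end a boundary point.\<close>

lemma tile_rel_edge:
  assumes xy: "(x, y) \<in> G" and out: "x \<notin> tile_bdry" "y \<notin> tile_bdry"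
  shows "(x, y) \<in> tile_rel"
proof -
  have layer: "\<exists>t b. b \<in> B t \<and> x \<in> piece (c t) b" if x: "x \<notin> tile_bdry" for x
  proof -
    obtain s where "x \<notin> A s" using x unfolding tile_bdry_def by blast
    then have "\<exists>t. x \<in> A t \<and> x \<notin> A (Suc t)" by (induction s) (auto simp: A_0)
    then show ?thesis unfolding A_Suc by blast
  qed
  have *: "(x, y) \<in> tile_rel" if "(x, y) \<in> G" "x \<notin> tile_bdry" "b \<in> B s" "x \<in> piece (c s) b"
    "b' \<in> B t" "y \<in> piece (c t) b'" "s \<le> t" for x y b b' s t
  proof -
    have "y \<in> A s" using that piece_A A_decr by blast
    moreover have "x \<notin> bdry G (A s) (piece (c s) b)" using that unfolding tile_bdry_def by blast
    ultimately have "y \<in> piece (c s) b" using that unfolding bdry_def by blast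
    then show ?thesis using that unfolding tile_rel_def by blast
  qed
  obtain s b t b' where sb: "b \<in> B s" "x \<in> piece (c s) b" "b' \<in> B t" "y \<in> piece (c t) b'"
    using layer out by meson
  show ?thesis
  proof (cases "s \<le> t")
    case True
    then show ?thesis using * xy out sb by blast
  next
    case False
    then have "(y, x) \<in> tile_rel" using *[of y x b' t b s] G_sym[OF xy] out sb by auto
    then show ?thesis using tile_rel_equiv by (meson equiv_def symD)
  qed
qed

lemma measure_tile_bdry:
  assumes \<mu>: "invariant_measure (G\<^sup>*) \<mu>" and null: "emeasure \<mu> (\<Inter>t. A t) = 0"
  shows "emeasure \<mu> tile_bdry \<le> ennreal \<delta>"
proof -
  have sets: "sets \<mu> = sets borel" and "prob_space \<mu>"
    using \<mu> by (simp_all add: invariant_measure_def)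
  interpret prob_space \<mu> by fact
  define Z where "Z = (\<lambda>t. \<Union>b\<in>B t. bdry G (A t) (piece (c t) b))"
  have Z: "range Z \<subseteq> sets \<mu>" unfolding Z_def sets using bdry_layer_sets by blast
  have A: "range (\<lambda>t. A t - A (Suc t)) \<subseteq> sets \<mu>" unfolding sets using sets.Diff[OF A_sets A_sets] by blast
  have "emeasure \<mu> tile_bdry \<le> emeasure \<mu> (\<Inter>t. A t) + emeasure \<mu> (\<Union>t. Z t)"
    unfolding tile_bdry_def Z_def[symmetric] 
    by (rule emeasure_subadditive) (use remainder_sets sets sets.countable_UN[OF Z] in auto)
  also have "\<dots> \<le> (\<Sum>t. emeasure \<mu> (Z t))"
    unfolding null using emeasure_subadditive_countably[OF Z] by simp
  also have "\<dots> \<le> (\<Sum>t. ennreal \<delta> * emeasure \<mu> (A t - A (Suc t)))"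
  proof (rule suminf_le)
    fix t
    have "A t - A (Suc t) = (\<Union>b\<in>B t. piece (c t) b)"
      using piece_A[of _ t] A_Suc[of t] by blast
    then show "emeasure \<mu> (Z t) \<le> ennreal \<delta> * emeasure \<mu> (A t - A (Suc t))"
      unfolding Z_def using measure_bdry_pieces[OF \<mu> A_sets B_sets B_disj \<delta>_nonneg, of t t] B_good[of t]
      by (auto simp: good_bases_def)
  qed auto
  also have "\<dots> = ennreal \<delta> * (\<Sum>t. emeasure \<mu> (A t - A (Suc t)))" by simp
  also have "(\<Sum>t. emeasure \<mu> (A t - A (Suc t))) = emeasure \<mu> (\<Union>t. A t - A (Suc t))"
    using layers_disjoint by (intro suminf_emeasure A) (auto simp: disjoint_family_on_def)
  also have "ennreal \<delta> * \<dots> \<le> ennreal \<delta> * 1"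
    by (intro mult_left_mono emeasure_le_1) simp
  finally show ?thesis by simp
qed

end

section \<open>From amenability to small-boundary partitions and hyperfiniteness\<close>

lemma gdist_relpow: "(x, y) \<in> G\<^sup>* \<Longrightarrow> (x, y) \<in> G ^^ gdist G x y"
  unfolding gdist_def using rtrancl_imp_relpow by (rule LeastI_ex)

lemma (in borel_graph_enumeration) borel_partition_small_boundary:
  assumes am: "uniformly_borel_amenable G" and "0 < \<delta>"
  obtains P Z n where "P \<in> sets (borel \<Otimes>\<^sub>M borel)" "equiv UNIV P" "P \<subseteq> reach n" "Z \<in> sets borel"
    "\<And>x y. (x, y) \<in> G \<Longrightarrow> x \<notin> Z \<Longrightarrow> y \<notin> Z \<Longrightarrow> (x, y) \<in> P"
    "\<And>\<mu>. invariant_measure (G\<^sup>*) \<mu> \<Longrightarrow> emeasure \<mu> Z \<le> ennreal \<delta>"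
proof -
  \<comment> \<open>The kernel of index \<open>m\<close> has variation below \<open>1 / m\<close>
    along each edge, the \<eta> of the null set criterion, which asks for
    \<open>D * \<eta> < \<delta>\<close>.\<close>
  obtain m :: nat where m: "real D / \<delta> < real m" using reals_Archimedean2 by blast
  have "0 \<le> real D / \<delta>" using \<open>0 < \<delta>\<close> by simp
  then have "0 < real m" using m by linarith
  then have "1 \<le> m" by simp
  have small: "real D * (1 / real m) < \<delta>"
    using m \<open>0 < real m\<close> \<open>0 < \<delta>\<close> by (simp add: field_simps)
  obtain p r where p: "p \<in> borel_measurable borel"
    and nonneg: "\<And>x y. (x, y) \<in> G\<^sup>* \<Longrightarrow> 0 \<le> p (x, y)"
    and sum1: "\<And>x. (\<Sum>\<^sub>\<infinity>y\<in>G\<^sup>* `` {x}. p (x, y)) = 1"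
    and grad: "\<And>x z. (x, z) \<in> G \<Longrightarrow> (\<Sum>\<^sub>\<infinity>y\<in>G\<^sup>* `` {x}. \<bar>p (x, y) - p (z, y)\<bar>) < 1 / real m"
    and supp: "\<And>x y. (x, y) \<in> G\<^sup>* \<Longrightarrow> r < real (gdist G x y) \<Longrightarrow> p (x, y) = 0"
    using am \<open>1 \<le> m\<close> unfolding uniformly_borel_amenable_def comp_rel_def by blast
  have pm: "p \<in> borel_measurable (borel \<Otimes>\<^sub>M borel)" unfolding borel_prod by (rule p)
  have reach: "(x, y) \<in> reach (nat \<lfloor>r\<rfloor>)" if "(x, y) \<in> G\<^sup>*" "p (x, y) \<noteq> 0" for x y
  proof -
    have "real (gdist G x y) \<le> r" using supp that by force
    then have "gdist G x y \<le> nat \<lfloor>r\<rfloor>" by (rule le_nat_floor)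
    then show ?thesis using gdist_relpow[OF that(1)] unfolding reach_def by blast
  qed
  obtain A B c where "foelner_tiling G e e' D (nat \<lfloor>r\<rfloor>) \<delta> A B c"
    using foelner_tiling_exists[of \<delta>] \<open>0 < \<delta>\<close> by (metis less_imp_le)
  then interpret foelner_tiling G e e' D "nat \<lfloor>r\<rfloor>" \<delta> A B c .
  have null: "emeasure \<mu> (\<Inter>t. A t) = 0" if \<mu>: "invariant_measure (G\<^sup>*) \<mu>" for \<mu>
  proof (rule null_set_without_foelner_subsets[OF \<mu> remainder_sets pm nonneg sum1 less_imp_le[OF grad]
      reach _ small less_imp_le[OF maximal]])
    show "F \<subseteq> (\<Inter>t. A t) \<inter> reach (nat \<lfloor>r\<rfloor>) `` {b}" if "F \<subseteq> (\<Inter>t. A t) \<inter> reach (nat \<lfloor>r\<rfloor>) `` {b}" for F b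
      by (fact that)
  qed simp_all
  show thesis
    by (rule that[OF tile_rel_sets tile_rel_equiv tile_rel_reach tile_bdry_sets tile_rel_edge
          measure_tile_bdry[OF _ null]])
qed

theorem theorem5:
  fixes G :: "('a::polish_space \<times> 'a) set"
  assumes "borel_graph G"
    and "uniformly_borel_amenable G"
    and "foelner_graph G"
  shows "\<exists>Y. Y \<in> sets (borel :: 'a measure) \<and>
           (\<forall>x y. (x, y) \<in> comp_rel G \<longrightarrow> (x \<in> Y \<longleftrightarrow> y \<in> Y)) \<and>
           hyperfinite_on Y (G \<inter> (Y \<times> Y)) \<and>
           (\<forall>\<mu>. invariant_measure (comp_rel G) \<mu> \<longrightarrow> emeasure \<mu> Y = 1)"
proof -
  obtain D where fin: "\<And>x. finite (G `` {x})" and card: "\<And>x. card (G `` {x}) \<le> D"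
    using assms(2) unfolding uniformly_borel_amenable_def bounded_degree_def by blast
  obtain e e' :: "nat \<Rightarrow> 'a \<Rightarrow> 'a" where e: "\<And>k. e k \<in> borel_measurable borel"
    "\<And>k. e' k \<in> borel_measurable borel" "\<And>k x. e k (e' k x) = x" "\<And>k x. e' k (e k x) = x"
    "\<And>x. G\<^sup>* `` {x} = range (\<lambda>k. e k x)"
    using component_enumeration[OF assms(1) fin] by blast
  have "sym G" using assms(1) by (simp add: borel_graph_def)
  then have equiv: "equiv UNIV (G\<^sup>*)"
    by (intro equivI) (auto simp: refl_rtrancl trans_rtrancl sym_rtrancl)
  interpret borel_graph_enumeration G e e' D
    by unfold_locales (fact equiv e assms(1) fin card)+
  have "\<exists>P Z n. P \<in> sets (borel \<Otimes>\<^sub>M borel) \<and> equiv UNIV P \<and> P \<subseteq> reach n \<and> Z \<in> sets borel \<and>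
    (\<forall>x y. (x, y) \<in> G \<longrightarrow> x \<notin> Z \<longrightarrow> y \<notin> Z \<longrightarrow> (x, y) \<in> P) \<and>
    (\<forall>\<mu>. invariant_measure (G\<^sup>*) \<mu> \<longrightarrow> emeasure \<mu> Z \<le> ennreal ((1/2)^i))" for i :: nat
  proof -
    have "(0::real) < (1/2)^i" by simp
    then show ?thesis
      by (rule borel_partition_small_boundary[OF assms(2)]) blast
  qed
  then obtain P Z d where [measurable]: "\<And>i. P i \<in> sets (borel \<Otimes>\<^sub>M borel)"
    and P_equiv: "\<And>i. equiv UNIV (P i)" and P_reach: "\<And>i. P i \<subseteq> reach (d i)"
    and [measurable]: "\<And>i. Z i \<in> sets borel"
    and P_edge: "\<And>i x y. (x, y) \<in> G \<Longrightarrow> x \<notin> Z i \<Longrightarrow> y \<notin> Z i \<Longrightarrow> (x, y) \<in> P i"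
    and Z_small: "\<And>i \<mu>. invariant_measure (G\<^sup>*) \<mu> \<Longrightarrow> emeasure \<mu> (Z i) \<le> ennreal ((1/2)^i)"
    by metis
  \<comment> \<open>Every point of the component must eventually avoid \<open>Z i\<close>, with no
    uniformity over the component; this makes \<open>Y\<close> a union of components and keeps it
    Borel.\<close>
  define Y where "Y = {x. \<forall>k. \<exists>N. \<forall>i\<ge>N. e k x \<notin> Z i}"
  \<comment> \<open>Tail intersections increase with \<open>n\<close>, and each refines
    \<open>P n\<close>, which bounds its classes.\<close>
  define E where "E = (\<lambda>n. (Y \<times> Y) \<inter> (\<Inter>i\<in>{n..}. P i))"
  have Y_sets[measurable]: "Y \<in> sets borel"
  proof -
    have "Y = {x \<in> space borel. \<forall>k. \<exists>N. \<forall>i. N \<le> i \<longrightarrow> e k x \<notin> Z i}" by (simp add: Y_def)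
    also have "\<dots> \<in> sets borel" by measurable
    finally show ?thesis .
  qed
  have Y_sub: "y \<in> Y" if xy: "(x, y) \<in> G\<^sup>*" and x: "x \<in> Y" for x y
  proof -
    have "\<exists>N. \<forall>i\<ge>N. e k y \<notin> Z i" for k
    proof -
      have "(x, e k y) \<in> G\<^sup>*" by (rule E_trans[OF xy E_e])
      then obtain j where j: "e k y = e j x" unfolding E_iff by blast
      show ?thesis using x by (simp add: Y_def j)
    qed
    then show ?thesis by (simp add: Y_def)
  qed
  have Y_inv: "x \<in> Y \<longleftrightarrow> y \<in> Y" if "(x, y) \<in> G\<^sup>*" for x y
    using Y_sub[OF that] Y_sub[OF E_sym[OF that]] by blast
  have Y_tail: "\<exists>N. \<forall>i\<ge>N. x \<notin> Z i" if x: "x \<in> Y" for x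
  proof -
    obtain k where k: "x = e k x" using E_refl[of x] unfolding E_iff by blast
    have "\<exists>N. \<forall>i\<ge>N. e k x \<notin> Z i" using x by (simp add: Y_def)
    then show ?thesis by (simp flip: k)
  qed
  \<comment> \<open>Hyperfiniteness measures distance in the restricted graph; paths of
    \<open>G\<close> starting in \<open>Y\<close> stay in \<open>Y\<close>, so the bounds carry
    over.\<close>
  have relpow_Y: "(x, y) \<in> (G \<inter> (Y \<times> Y)) ^^ k" if "(x, y) \<in> G ^^ k" "x \<in> Y" for x y k
    using that(1)
  proof (induction k arbitrary: y)
    case (Suc k)
    then obtain z where z: "(x, z) \<in> G ^^ k" "(z, y) \<in> G" by auto
    then have "(x, z) \<in> G\<^sup>*" "(x, y) \<in> G\<^sup>*"
      using relpow_imp_rtrancl rtrancl_into_rtrancl by metis+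
    then have "z \<in> Y" "y \<in> Y" using Y_sub[OF _ that(2)] by auto
    then show ?case using Suc.IH[OF z(1)] z(2) by auto
  qed simp
  have E_reach: "E n \<subseteq> reach (d n)" for n using P_reach unfolding E_def by auto
  have "hyperfinite_on Y (G \<inter> (Y \<times> Y))"
    unfolding hyperfinite_on_def
  proof (intro exI[of _ E] conjI allI ballI impI)
    fix n
    show "equiv Y (E n)"
    proof (rule equivI)
      show "refl_on Y (E n)"
        using P_equiv by (auto simp: E_def refl_on_def equiv_def)
      show "sym (E n)"
        using P_equiv unfolding E_def equiv_def sym_def by blast
      show "trans (E n)"
        using P_equiv unfolding E_def equiv_def trans_def by blast
    qed (auto simp: E_def)
    have "E n \<in> sets (borel \<Otimes>\<^sub>M borel)" unfolding E_def by measurable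
    then show "E n \<in> sets borel" by (simp add: sets_borel_prod)
    show "finite (E n `` {x})" for x
      using E_reach finite_reach finite_subset by (metis Image_mono order_refl)
    show "E n \<subseteq> E (Suc n)" unfolding E_def by auto
    have "(x, y) \<in> comp_rel (G \<inter> (Y \<times> Y)) \<and> gdist (G \<inter> (Y \<times> Y)) x y \<le> d n" if xy: "(x, y) \<in> E n" for x y
    proof -
      obtain k where k: "k \<le> d n" "(x, y) \<in> G ^^ k"
        using subsetD[OF E_reach xy] unfolding reach_def by blast
      have "x \<in> Y" using xy unfolding E_def by blast
      then have "(x, y) \<in> (G \<inter> (Y \<times> Y)) ^^ k" using relpow_Y k(2) by blast
      then show ?thesis
        using k(1) Least_le[of "\<lambda>n. (x, y) \<in> (G \<inter> (Y \<times> Y)) ^^ n" k] relpow_imp_rtrancl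
        unfolding comp_rel_def gdist_def by fastforce
    qed
    then show "\<exists>b. \<forall>x y. (x, y) \<in> E n \<longrightarrow> (x, y) \<in> comp_rel (G \<inter> (Y \<times> Y)) \<and> gdist (G \<inter> (Y \<times> Y)) x y \<le> b"
      by blast
  next
    fix x y assume xy: "(x, y) \<in> G \<inter> (Y \<times> Y)"
    obtain N1 where N1: "\<forall>i\<ge>N1. x \<notin> Z i" using xy Y_tail by blast
    obtain N2 where N2: "\<forall>i\<ge>N2. y \<notin> Z i" using xy Y_tail by blast
    have "(x, y) \<in> E n" if "max N1 N2 \<le> n" for n
      using xy P_edge N1 N2 that unfolding E_def by auto
    then show "\<exists>N. \<forall>n\<ge>N. (x, y) \<in> E n" by blast
  qed
  moreover have "emeasure \<mu> Y = 1" if \<mu>: "invariant_measure (G\<^sup>*) \<mu>" for \<mu>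
  proof -
    have sets: "sets \<mu> = sets borel" and "prob_space \<mu>"
      using \<mu> by (simp_all add: invariant_measure_def)
    interpret prob_space \<mu> by fact
    have small: "measure \<mu> (Z i) \<le> (1/2)^i" for i
      using Z_small[OF \<mu>, of i] by (simp add: emeasure_eq_measure)
    have "AE x in \<mu>. \<forall>\<^sub>F i in sequentially. x \<in> space \<mu> - Z i"
    proof (rule borel_cantelli_AE1)
      show "Z i \<in> sets \<mu>" for i using sets by simp
      show "summable (\<lambda>i. measure \<mu> (Z i))"
        by (rule summable_comparison_test'[OF summable_geometric[of "1/2"]]) (use small in auto)
    qed (simp add: emeasure_eq_measure)
    then have AE: "AE x in \<mu>. \<exists>N. \<forall>i. N \<le> i \<longrightarrow> x \<notin> Z i"
      by (rule AE_mp) (auto simp: eventually_sequentially)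
    \<comment> \<open>Borel-Cantelli speaks of \<open>x\<close> alone; invariance under the
      bijection \<open>e k\<close> carries it to \<open>e k x\<close>, and the countably many
      \<open>k\<close> together give membership in \<open>Y\<close>.\<close>
    have "AE x in \<mu>. \<exists>N. \<forall>i. N \<le> i \<longrightarrow> e k x \<notin> Z i" for k
    proof -
      have "bij (e k)" by (rule o_bij[of "e' k"]) (auto simp: fun_eq_iff)
      then have distr: "distr \<mu> \<mu> (e k) = \<mu>"
        using \<mu> by (simp add: invariant_measure_def)
      have ek: "e k \<in> measurable \<mu> \<mu>" by (simp cong: measurable_cong_sets add: sets)
      have "{x \<in> space borel. \<exists>N. \<forall>i. N \<le> i \<longrightarrow> x \<notin> Z i} \<in> sets borel" by measurable
      then have "{x \<in> space \<mu>. \<exists>N. \<forall>i. N \<le> i \<longrightarrow> x \<notin> Z i} \<in> sets \<mu>"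
        by (simp add: sets sets_eq_imp_space_eq[OF sets])
      from AE_distr_iff[OF ek this] show ?thesis using AE unfolding distr by (rule iffD1)
    qed
    then have "AE x in \<mu>. x \<in> Y"
      unfolding Y_def mem_Collect_eq by (simp add: AE_all_countable)
    then show ?thesis
      using emeasure_eq_1_AE[of Y] Y_sets sets by simp
  qed
  ultimately show ?thesis
    using Y_sets Y_inv unfolding comp_rel_def by blast
qed

end
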